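(* Let $d\ge 2$ and let $\overline{\mathcal C}$ be the distance-$d$ unrotated-surface-code encoding of a realization of a bare circuit $\mathcal C$, with one round of parity-check measurements after each layer of logical gates, as described in the context. Let $O$ be a reliable observable of $\mathcal C$, with decoding subgraph $G_O=(V_O,E_O)$ and observing edge set $\mathcal H_O$. Then the single-LOM decoder applied to $G_O$ correctly predicts whether any basic error of weight $w<d/2$ has flipped $O$. That is: let $F$ be any set of $w<d/2$ basic faults in $\overline{\mathcal C}$, let $D\subseteq V_O$ be the set of detectors in $V_O$ that are flipped by $F$, and let $\vec c\subseteq E_O$ be any set of edges of minimum cardinality among all sets of edges whose boundary is $D$; then $\vec c$ contains an odd number of edges of $\mathcal H_O$ if and only if the error $F$ flips the (raw) outcome of $O$.
   Context: **Bare circuit.** $\mathcal C$ acts on qubits labelled $j$; layers of operations occur at times $t+\tfrac12$, $t\in\mathbb Z$. All conditional gates are taken as fixed (a "realization" of the circuit). Each qubit starts with a reset (to $|0\rangle$, $|+\rangle$ or $|T\rangle$) in some layer, then in every subsequent layer undergoes exactly one of $I$, $H$, $S$, or takes part in one $\mathrm{CNOT}$, until it is destructively measured in the $Z$ or $X$ basis. A circuit location $(t,j)$, $t\in\mathbb Z$, is a point between layers $t-\frac12$ and $t+\frac12$ at which qubit $j$ is active. Pauli gates and phases of Paulis are ignored. A Pauli region is an assignment $P=[P_{(t,j)}]$ of a Pauli in $\{I,X,Y,Z\}$ to every circuit location; two Pauli regions anticommute if their components anticommute at an odd number of locations. **Observables.** An observable $O$ is a non-empty set of measurements; its outcome is the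 parity of their outcomes. Its observing region $O^{\leftarrow}$ is the Pauli region obtained as follows: at a location directly before a $Z$- (resp. $X$-) measurement belonging to $O$ put $Z$ (resp. $X$), and directly before a measurement not in $O$ put $I$; then go backwards in time, where for locations before a layer of Clifford gates $C$ at time $t+\frac12$ acting on qubits $J$ put $O^{\leftarrow}_{(t,J)}=C^\dagger O^{\leftarrow}_{(t+1,J)}C$ (nothing propagates back beyond a reset). A reset stabilizer is a set of $|0\rangle$- and/or $|+\rangle$-resets, with Pauli region having $Z$ (resp. $X$) at the location directly after each $|0\rangle$- (resp. $|+\rangle$-) reset in the set and $I$ elsewhere. $O$ is *fragile* if $O^{\leftarrow}$ anticommutes with some reset stabilizer, and *reliable* otherwise. ($|T\rangle$-resets do not contribute reset stabilizers.) **Encoding.** Each qubit $j$ is encoded in an unrotated surface code with sites $(x,y)\in(\frac12\mathbb Z)^2$, $0\le x,y\le d-1$: data qubits have $x+y\in\mathbb Z$; $X$-checks sit at $x\in\mathbb Z$, $y\in\mathbb Z+\frac12$; $Z$-checks at $x\in\mathbb Z+\frac12$, $y\in\mathbb Z$. A check at $(x,y)$ acts on those of the data qubits $(x\pm\frac12,y)$, $(x,y\pm\frac12)$ that exist. The logical representatives are boundary strings $\overline X=\prod_{x=0}^{d-1}X_{(x,d-1)}$ and $\overline Z=\prod_{y=0}^{d-1}Z_{(d-1,y)}$. Logical operations are transversal: $|\overline 0\rangle$, $|\overline +\rangle$ resets and $\overline Z,\overline X$ measurements act on all data qubits; $|\overline T\rangle$ is prepared fault-tolerantly with all checks known; $\overline{\mathrm{CNOT}}$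 is qubit-wise; $\overline H$ is qubit-wise $H$ followed by SWAPs of $(x,y)$ with $(y,x)$; $\overline S$ is $S$ or $S^\dagger$ on the diagonal qubits (alternating) and CZ between $(x,y)$ and $(y,x)$. After each layer $t+\frac12$ of gates (including identity gates) every check is measured, with outcome $m(t+\frac12,j,x,y)$. A $\overline Z$- (resp. $\overline X$-) measurement in layer $t+\frac12$ gives an outcome for every data qubit. The raw outcome of $O$ is the parity, taken over all measurements in $O$, of the data-qubit outcomes of the measured code block at the sites $(d-1,y)$, $y=0,1,\dots,d-1$, i.e. the support of $\overline Z=\prod_{y=0}^{d-1}Z_{(d-1,y)}$, for a $\overline Z$-measurement (resp. at the sites $(x,d-1)$, $x=0,1,\dots,d-1$, i.e. the support of $\overline X=\prod_{x=0}^{d-1}X_{(x,d-1)}$, for an $\overline X$-measurement). **Detectors (pre-gate frame).** For a location $(t,j)$ and each check at $(x,y)$ there is a detector $d(t,j,x,y)$, called an $X$- or $Z$-detector according to the check type. It is the parity of $m(t-\frac12,j,x,y)$ and the following outcomes of layer $t+\frac12$: - $I$ on $j$: $m(t+\frac12,j,x,y)$. - $H$ on $j$: $m(t+\frac12,j,y,x)$. - $S$ on $j$: for $Z$-detectors $m(t+\frac12,j,x,y)$; for $X$-detectors $m(t+\frac12,j,x,y)$ and $m(t+\frac12,j,y,x)$. - $\mathrm{CNOT}$ with control $j_1$ and target $j_2$: for $Z$-detectors of $j_1$ and $X$-detectors of $j_2$ only the outcome of the same check of the same qubit; for $X$-detectors of $j_1$ and $Z$-detectors of $j_2$ the outcomes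 of the check at $(x,y)$ on both $j_1$ and $j_2$. - $\overline Z$- (resp. $\overline X$-) measurement of $j$: for $Z$- (resp. $X$-) detectors, the outcomes of all data qubits in the support of the check; detectors of the other type do not exist at $(t,j)$. If layer $t-\frac12$ is the reset of qubit $j$, the term $m(t-\frac12,j,x,y)$ is omitted, and the detector exists only for $Z$-checks after a $|\overline0\rangle$ reset, only for $X$-checks after $|\overline+\rangle$, and for both after $|\overline T\rangle$. **Basic faults.** A basic fault is one of: a Pauli $X$ on one data qubit at one location $(t,j)$ (directly before layer $t+\frac12$); a Pauli $Z$ on one data qubit at one location; or the flip of one recorded physical measurement outcome (of a check or of a data qubit). A basic error of weight $w$ is a set of $w$ basic faults; it flips a detector or $O$ iff an odd number of its faults individually do. **Decoding hypergraph and subgraph.** The decoding hypergraph $\mathcal G=(\mathcal V,\mathcal H)$ has the detectors as vertices and one hyperedge for each basic fault, namely the set of detectors it flips. The observing edge set $\mathcal H_O$ is the set of hyperedges whose fault flips the raw outcome of $O$; these are data-qubit faults at $(t,j)$ anticommuting with the logical lift of $O^{\leftarrow}_{(t,j)}$ (obtained by replacing $X$ by $\overline X=\prod_{x=0}^{d-1}X_{(x,d-1)}$, $Z$ by $\overline Z=\prod_{y=0}^{d-1}Z_{(d-1,y)}$, and $Y$ by the product of these two strings, on code block $j$), or equivalent data-outcome flips, and each touches only one vertex of the relevant type, on a spatial boundary. $V_O\subseteq\mathcal V$ consists of all detectors that have the same location $(t,j)$ and the same type ($X$ or $Z$) as a vertex of some hyperedge in $\mathcal H_O$; i.e. all $Z$-detectors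 at $(t,j)$ if $O^{\leftarrow}_{(t,j)}\in\{Z,Y\}$ and all $X$-detectors at $(t,j)$ if $O^{\leftarrow}_{(t,j)}\in\{X,Y\}$. Finally $E_O=\{h\cap V_O: h\in\mathcal H,\ h\cap V_O\ne\emptyset\}$; each element has one or two vertices, and $\mathcal H_O\subseteq E_O$. The boundary of a set of edges $\vec c\subseteq E_O$ is the set of vertices of $V_O$ contained in an odd number of edges of $\vec c$ (edges with a single vertex are connected to the boundary). All edges have weight one. **Single-LOM decoder.** Given the set $D\subseteq V_O$ of flipped detectors in $V_O$, the decoder finds a minimum-weight set $\vec c\subseteq E_O$ with boundary $D$ (minimum-weight perfect matching) and predicts that $O$ has been flipped iff $\vec c$ contains an odd number of edges of $\mathcal H_O$. *)

theory Defs
  imports Main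
begin

section \<open>Paulis up to phase\<close>

text \<open>
  A single-qubit Pauli up to phase is the pair \<open>(x, z)\<close> standing for \<open>X\<^sup>x Z\<^sup>z\<close>; thus \<open>Y\<close> is
  \<open>(True, True)\<close>. Multiplication is componentwise exclusive or.
\<close>

type_synonym pauli = "bool \<times> bool"

abbreviation PI :: pauli where "PI \<equiv> (False, False)"
abbreviation PX :: pauli where "PX \<equiv> (True, False)"
abbreviation PZ :: pauli where "PZ \<equiv> (False, True)"

definition anticommute :: "pauli \<Rightarrow> pauli \<Rightarrow> bool" where
  "anticommute p q \<longleftrightarrow> ((fst p \<and> snd q) \<noteq> (snd p \<and> fst q))"

text \<open>
  Conjugation of Paulis by Clifford gates. Up to phase, conjugation by each of these gates and by
  its inverse (in particular \<open>S\<close> and \<open>S\<^sup>\<dagger>\<close>) is the same map, so the same functions serve for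
  propagation forwards and backwards in time. For the two-qubit gates, the first argument is the
  Pauli on the qubit whose new Pauli is computed, and the second one that on its partner.
\<close>

definition conj_H :: "pauli \<Rightarrow> pauli" where
  "conj_H p = (snd p, fst p)"

definition conj_S :: "pauli \<Rightarrow> pauli" where
  "conj_S p = (fst p, snd p \<noteq> fst p)"

definition conj_CZ :: "pauli \<Rightarrow> pauli \<Rightarrow> pauli" where
  "conj_CZ p q = (fst p, snd p \<noteq> fst q)"

definition conj_CNOT_control :: "pauli \<Rightarrow> pauli \<Rightarrow> pauli" where
  "conj_CNOT_control p q = (fst p, snd p \<noteq> snd q)"

definition conj_CNOT_target :: "pauli \<Rightarrow> pauli \<Rightarrow> pauli" where
  "conj_CNOT_target p q = (fst p \<noteq> fst q, snd p)"


section \<open>Bare circuits\<close>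

datatype reset = Reset0 | ResetPlus | ResetT

datatype basis = ZBasis | XBasis

text \<open>\<open>Control k\<close>: the qubit is the control of a CNOT with target \<open>k\<close>; dually for \<open>Target k\<close>.\<close>

datatype 'q gate = GateI | GateH | GateS | Control 'q | Target 'q

datatype 'q operation = Inactive | Reset reset | Gate "'q gate" | Measure basis

text \<open>\<open>C t j\<close> is what happens to qubit \<open>j\<close> in the layer at time \<open>t + 1/2\<close>.\<close>

type_synonym 'q circuit = "int \<Rightarrow> 'q \<Rightarrow> 'q operation"

definition qubits :: "'q circuit \<Rightarrow> 'q set" where
  "qubits C = {j. \<exists>t. C t j \<noteq> Inactive}"

definition bare_circuit :: "'q circuit \<Rightarrow> bool" where
  "bare_circuit C \<longleftrightarrow>
     finite (qubits C) \<and>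
     (\<forall>j\<in>qubits C. \<exists>r m. r < m \<and>
        (\<exists>k. C r j = Reset k) \<and>
        (\<forall>t. r < t \<and> t < m \<longrightarrow> (\<exists>g. C t j = Gate g)) \<and>
        (\<exists>b. C m j = Measure b) \<and>
        (\<forall>t. t < r \<or> m < t \<longrightarrow> C t j = Inactive)) \<and>
     (\<forall>t j k. C t j = Gate (Control k) \<longleftrightarrow> C t k = Gate (Target j))"

text \<open>\<open>(t, j)\<close> is the point between the layers at times \<open>t - 1/2\<close> and \<open>t + 1/2\<close>.\<close>

definition locations :: "'q circuit \<Rightarrow> (int \<times> 'q) set" where
  "locations C = {(t, j). (\<exists>k. C (t - 1) j = Reset k) \<or> (\<exists>g. C (t - 1) j = Gate g)}"

text \<open>The pair \<open>(t, j)\<close> here denotes the measurement of qubit \<open>j\<close> in the layer at \<open>t + 1/2\<close>.\<close>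

definition measurements :: "'q circuit \<Rightarrow> (int \<times> 'q) set" where
  "measurements C = {(t, j). \<exists>b. C t j = Measure b}"

definition observable :: "'q circuit \<Rightarrow> (int \<times> 'q) set \<Rightarrow> bool" where
  "observable C M \<longleftrightarrow> M \<noteq> {} \<and> M \<subseteq> measurements C"

fun basis_pauli :: "basis \<Rightarrow> pauli" where
  "basis_pauli ZBasis = PZ"
| "basis_pauli XBasis = PX"


section \<open>Pauli regions and reliability of observables\<close>

type_synonym 'q region = "int \<Rightarrow> 'q \<Rightarrow> pauli"

definition region_anticommute :: "'q circuit \<Rightarrow> 'q region \<Rightarrow> 'q region \<Rightarrow> bool" where
  "region_anticommute C P Q \<longleftrightarrow>
     odd (card {(t, j). (t, j) \<in> locations C \<and> anticommute (P t j) (Q t j)})"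

text \<open>The Paulis at time \<open>t\<close>, computed from the Paulis \<open>P\<close> at time \<open>t + 1\<close>.\<close>

definition back_layer ::
  "'q circuit \<Rightarrow> (int \<times> 'q) set \<Rightarrow> int \<Rightarrow> ('q \<Rightarrow> pauli) \<Rightarrow> 'q \<Rightarrow> pauli" where
  "back_layer C M t P j =
     (case C t j of
        Inactive \<Rightarrow> PI
      | Reset k \<Rightarrow> PI
      | Measure b \<Rightarrow> (if (t, j) \<in> M then basis_pauli b else PI)
      | Gate g \<Rightarrow>
          (case g of
             GateI \<Rightarrow> P j
           | GateH \<Rightarrow> conj_H (P j)
           | GateS \<Rightarrow> conj_S (P j)
           | Control k \<Rightarrow> conj_CNOT_control (P j) (P k)
           | Target k \<Rightarrow> conj_CNOT_target (P j) (P k)))"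

definition last_time :: "(int \<times> 'q) set \<Rightarrow> int" where
  "last_time M = Max (fst ` M)"

text \<open>The Paulis at time \<open>last_time M + 1 - n\<close>.\<close>

primrec back_from :: "'q circuit \<Rightarrow> (int \<times> 'q) set \<Rightarrow> nat \<Rightarrow> 'q \<Rightarrow> pauli" where
  "back_from C M 0 = (\<lambda>j. PI)"
| "back_from C M (Suc n) = back_layer C M (last_time M - int n) (back_from C M n)"

definition observing_region :: "'q circuit \<Rightarrow> (int \<times> 'q) set \<Rightarrow> 'q region" where
  "observing_region C M t = back_from C M (nat (last_time M + 1 - t))"

text \<open>The pair \<open>(t, j)\<close> here denotes the reset of qubit \<open>j\<close> in the layer at \<open>t + 1/2\<close>.\<close>

definition stabilizer_resets :: "'q circuit \<Rightarrow> (int \<times> 'q) set" where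
  "stabilizer_resets C = {(t, j). C t j = Reset Reset0 \<or> C t j = Reset ResetPlus}"

definition reset_region :: "'q circuit \<Rightarrow> (int \<times> 'q) set \<Rightarrow> 'q region" where
  "reset_region C R t j =
     (if (t - 1, j) \<in> R \<and> C (t - 1) j = Reset Reset0 then PZ
      else if (t - 1, j) \<in> R \<and> C (t - 1) j = Reset ResetPlus then PX
      else PI)"

definition fragile :: "'q circuit \<Rightarrow> (int \<times> 'q) set \<Rightarrow> bool" where
  "fragile C M \<longleftrightarrow>
     (\<exists>R \<subseteq> stabilizer_resets C. region_anticommute C (observing_region C M) (reset_region C R))"

definition reliable :: "'q circuit \<Rightarrow> (int \<times> 'q) set \<Rightarrow> bool" where
  "reliable C M \<longleftrightarrow> \<not> fragile C M"


section \<open>The unrotated surface code\<close>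

text \<open>
  Coordinates are doubled: the pair \<open>(a, b)\<close> of integers is the site \<open>(x, y) = (a/2, b/2)\<close>.
  Hence \<open>x \<in> \<int>\<close> becomes \<open>even a\<close>, \<open>x \<in> \<int> + 1/2\<close> becomes \<open>odd a\<close>, and \<open>x + y \<in> \<int>\<close> becomes
  \<open>even (a + b)\<close>.
\<close>

type_synonym site = "int \<times> int"

definition sites :: "nat \<Rightarrow> site set" where
  "sites d = {0..2 * (int d - 1)} \<times> {0..2 * (int d - 1)}"

definition data_sites :: "nat \<Rightarrow> site set" where
  "data_sites d = {(a, b). (a, b) \<in> sites d \<and> even (a + b)}"

definition is_X_check :: "site \<Rightarrow> bool" where
  "is_X_check s \<longleftrightarrow> even (fst s) \<and> odd (snd s)"

definition is_Z_check :: "site \<Rightarrow> bool" where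
  "is_Z_check s \<longleftrightarrow> odd (fst s) \<and> even (snd s)"

definition checks :: "nat \<Rightarrow> site set" where
  "checks d = {s \<in> sites d. is_X_check s \<or> is_Z_check s}"

definition check_support :: "nat \<Rightarrow> site \<Rightarrow> site set" where
  "check_support d s =
     (case s of (a, b) \<Rightarrow> {(a - 1, b), (a + 1, b), (a, b - 1), (a, b + 1)} \<inter> data_sites d)"

definition check_pauli :: "site \<Rightarrow> pauli" where
  "check_pauli s = (if is_X_check s then PX else PZ)"

definition reflect :: "site \<Rightarrow> site" where
  "reflect s = (snd s, fst s)"

fun logical_support :: "nat \<Rightarrow> basis \<Rightarrow> site set" where
  "logical_support d ZBasis = {(2 * (int d - 1), 2 * y) | y. 0 \<le> y \<and> y \<le> int d - 1}"
| "logical_support d XBasis = {(2 * x, 2 * (int d - 1)) | x. 0 \<le> x \<and> x \<le> int d - 1}"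


section \<open>Recorded outcomes of the encoded circuit\<close>

text \<open>
  \<open>CheckOutcome t j s\<close> is the outcome \<open>m(t + 1/2, j, x, y)\<close> of the check at site \<open>s\<close> after the
  gates of the layer at \<open>t + 1/2\<close>; \<open>DataOutcome t j s\<close> is the outcome of the data qubit at site \<open>s\<close>
  in the destructive measurement of block \<open>j\<close> in that layer.
\<close>

datatype 'q outcome = CheckOutcome int 'q site | DataOutcome int 'q site

definition outcomes :: "'q circuit \<Rightarrow> nat \<Rightarrow> 'q outcome set" where
  "outcomes C d =
     {CheckOutcome t j s | t j s. (\<exists>g. C t j = Gate g) \<and> s \<in> checks d} \<union>
     {DataOutcome t j s | t j s. (\<exists>b. C t j = Measure b) \<and> s \<in> data_sites d}"

definition raw_outcome :: "'q circuit \<Rightarrow> nat \<Rightarrow> (int \<times> 'q) set \<Rightarrow> 'q outcome set" where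
  "raw_outcome C d M =
     {DataOutcome t j s | t j s b. (t, j) \<in> M \<and> C t j = Measure b \<and> s \<in> logical_support d b}"


section \<open>Detectors\<close>

text \<open>The detector \<open>d(t, j, x, y)\<close>, for the check at site \<open>s = (x, y)\<close>, is the triple \<open>(t, j, s)\<close>.\<close>

type_synonym 'q detector = "int \<times> 'q \<times> site"

definition detectors :: "'q circuit \<Rightarrow> nat \<Rightarrow> 'q detector set" where
  "detectors C d =
     {(t, j, s). (t, j) \<in> locations C \<and> s \<in> checks d \<and>
        (C (t - 1) j = Reset Reset0 \<longrightarrow> is_Z_check s) \<and>
        (C (t - 1) j = Reset ResetPlus \<longrightarrow> is_X_check s) \<and>
        (C t j = Measure ZBasis \<longrightarrow> is_Z_check s) \<and>
        (C t j = Measure XBasis \<longrightarrow> is_X_check s)}"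

definition earlier_outcomes :: "'q circuit \<Rightarrow> int \<Rightarrow> 'q \<Rightarrow> site \<Rightarrow> 'q outcome set" where
  "earlier_outcomes C t j s =
     (if \<exists>g. C (t - 1) j = Gate g then {CheckOutcome (t - 1) j s} else {})"

definition later_outcomes :: "'q circuit \<Rightarrow> nat \<Rightarrow> int \<Rightarrow> 'q \<Rightarrow> site \<Rightarrow> 'q outcome set" where
  "later_outcomes C d t j s =
     (case C t j of
        Inactive \<Rightarrow> {}
      | Reset k \<Rightarrow> {}
      | Measure b \<Rightarrow> DataOutcome t j ` check_support d s
      | Gate g \<Rightarrow>
          (case g of
             GateI \<Rightarrow> {CheckOutcome t j s}
           | GateH \<Rightarrow> {CheckOutcome t j (reflect s)}
           | GateS \<Rightarrow>
               (if is_X_check s then {CheckOutcome t j s, CheckOutcome t j (reflect s)}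
                else {CheckOutcome t j s})
           | Control k \<Rightarrow>
               (if is_X_check s then {CheckOutcome t j s, CheckOutcome t k s}
                else {CheckOutcome t j s})
           | Target k \<Rightarrow>
               (if is_Z_check s then {CheckOutcome t j s, CheckOutcome t k s}
                else {CheckOutcome t j s})))"

fun detector_outcomes :: "'q circuit \<Rightarrow> nat \<Rightarrow> 'q detector \<Rightarrow> 'q outcome set" where
  "detector_outcomes C d (t, j, s) = earlier_outcomes C t j s \<union> later_outcomes C d t j s"

fun same_kind :: "'q detector \<Rightarrow> 'q detector \<Rightarrow> bool" where
  "same_kind (t, j, s) (t', j', s') \<longleftrightarrow> t = t' \<and> j = j' \<and> is_X_check s = is_X_check s'"


section \<open>Basic faults and the outcomes they flip\<close>

text \<open>An error assigns a Pauli to every data qubit of every code block, at a fixed time.\<close>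

type_synonym 'q error = "'q \<Rightarrow> site \<Rightarrow> pauli"

text \<open>
  Propagation through the transversal physical gates of the layer at \<open>t + 1/2\<close>. Logical \<open>H\<close> acts
  by \<open>H\<close> on every data qubit and then moves the qubit at \<open>(y, x)\<close> to \<open>(x, y)\<close>; logical \<open>S\<close> acts by
  \<open>S\<close> or its inverse on the diagonal and by CZ on reflected pairs.
\<close>

definition push_layer :: "'q circuit \<Rightarrow> int \<Rightarrow> 'q error \<Rightarrow> 'q error" where
  "push_layer C t E j s =
     (case C t j of
        Inactive \<Rightarrow> PI
      | Reset k \<Rightarrow> PI
      | Measure b \<Rightarrow> PI
      | Gate g \<Rightarrow>
          (case g of
             GateI \<Rightarrow> E j s
           | GateH \<Rightarrow> conj_H (E j (reflect s))
           | GateS \<Rightarrow>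
               (if fst s = snd s then conj_S (E j s) else conj_CZ (E j s) (E j (reflect s)))
           | Control k \<Rightarrow> conj_CNOT_control (E j s) (E k s)
           | Target k \<Rightarrow> conj_CNOT_target (E j s) (E k s)))"

text \<open>The error at time \<open>t + n\<close> resulting from the error \<open>E\<close> at time \<open>t\<close>.\<close>

primrec evolve :: "'q circuit \<Rightarrow> int \<Rightarrow> 'q error \<Rightarrow> nat \<Rightarrow> 'q error" where
  "evolve C t E 0 = E"
| "evolve C t E (Suc n) = push_layer C (t + int n) (evolve C t E n)"

definition single_error :: "pauli \<Rightarrow> 'q \<Rightarrow> site \<Rightarrow> 'q error" where
  "single_error p j s = (\<lambda>j' s'. if j' = j \<and> s' = s then p else PI)"

definition check_flipped :: "nat \<Rightarrow> 'q error \<Rightarrow> 'q \<Rightarrow> site \<Rightarrow> bool" where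
  "check_flipped d E j s \<longleftrightarrow>
     odd (card {q \<in> check_support d s. anticommute (E j q) (check_pauli s)})"

text \<open>
  Whether the error \<open>E\<close>, occurring at time \<open>t\<close>, flips an outcome. The checks recorded in the layer
  at \<open>u + 1/2\<close> are measured after the gates of that layer, hence see the error propagated to time
  \<open>u + 1\<close> (without faults occurring at \<open>u + 1\<close>); data-qubit measurements in that layer see the
  error at time \<open>u\<close>.
\<close>

fun error_flips :: "'q circuit \<Rightarrow> nat \<Rightarrow> int \<Rightarrow> 'q error \<Rightarrow> 'q outcome \<Rightarrow> bool" where
  "error_flips C d t E (CheckOutcome u j s) \<longleftrightarrow>
     t \<le> u \<and> check_flipped d (evolve C t E (nat (u + 1 - t))) j s"
| "error_flips C d t E (DataOutcome u j s) \<longleftrightarrow>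
     t \<le> u \<and>
     (\<exists>b. C u j = Measure b \<and> anticommute (evolve C t E (nat (u - t)) j s) (basis_pauli b))"

datatype 'q fault = XFault int 'q site | ZFault int 'q site | OutcomeFlip "'q outcome"

definition basic_faults :: "'q circuit \<Rightarrow> nat \<Rightarrow> 'q fault set" where
  "basic_faults C d =
     {XFault t j s | t j s. (t, j) \<in> locations C \<and> s \<in> data_sites d} \<union>
     {ZFault t j s | t j s. (t, j) \<in> locations C \<and> s \<in> data_sites d} \<union>
     OutcomeFlip ` outcomes C d"

fun fault_flips_outcome :: "'q circuit \<Rightarrow> nat \<Rightarrow> 'q fault \<Rightarrow> 'q outcome \<Rightarrow> bool" where
  "fault_flips_outcome C d (XFault t j s) m = error_flips C d t (single_error PX j s) m"
| "fault_flips_outcome C d (ZFault t j s) m = error_flips C d t (single_error PZ j s) m"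
| "fault_flips_outcome C d (OutcomeFlip m') m = (m' = m)"

definition fault_flips_detector :: "'q circuit \<Rightarrow> nat \<Rightarrow> 'q fault \<Rightarrow> 'q detector \<Rightarrow> bool" where
  "fault_flips_detector C d f v \<longleftrightarrow>
     odd (card {m \<in> detector_outcomes C d v. fault_flips_outcome C d f m})"

definition fault_flips_observable ::
  "'q circuit \<Rightarrow> nat \<Rightarrow> (int \<times> 'q) set \<Rightarrow> 'q fault \<Rightarrow> bool" where
  "fault_flips_observable C d M f \<longleftrightarrow>
     odd (card {m \<in> raw_outcome C d M. fault_flips_outcome C d f m})"

definition flips_detector :: "'q circuit \<Rightarrow> nat \<Rightarrow> 'q fault set \<Rightarrow> 'q detector \<Rightarrow> bool" where
  "flips_detector C d F v \<longleftrightarrow> odd (card {f \<in> F. fault_flips_detector C d f v})"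

definition flips_observable ::
  "'q circuit \<Rightarrow> nat \<Rightarrow> (int \<times> 'q) set \<Rightarrow> 'q fault set \<Rightarrow> bool" where
  "flips_observable C d M F \<longleftrightarrow> odd (card {f \<in> F. fault_flips_observable C d M f})"


section \<open>Decoding hypergraph, decoding subgraph and decoder\<close>

definition hyperedge :: "'q circuit \<Rightarrow> nat \<Rightarrow> 'q fault \<Rightarrow> 'q detector set" where
  "hyperedge C d f = {v \<in> detectors C d. fault_flips_detector C d f v}"

definition hyperedges :: "'q circuit \<Rightarrow> nat \<Rightarrow> 'q detector set set" where
  "hyperedges C d = hyperedge C d ` basic_faults C d"

definition observing_edges :: "'q circuit \<Rightarrow> nat \<Rightarrow> (int \<times> 'q) set \<Rightarrow> 'q detector set set" where
  "observing_edges C d M =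
     hyperedge C d ` {f \<in> basic_faults C d. fault_flips_observable C d M f}"

definition decoding_vertices :: "'q circuit \<Rightarrow> nat \<Rightarrow> (int \<times> 'q) set \<Rightarrow> 'q detector set" where
  "decoding_vertices C d M =
     {v \<in> detectors C d. \<exists>h \<in> observing_edges C d M. \<exists>w \<in> h. same_kind v w}"

definition decoding_edges :: "'q circuit \<Rightarrow> nat \<Rightarrow> (int \<times> 'q) set \<Rightarrow> 'q detector set set" where
  "decoding_edges C d M =
     {h \<inter> decoding_vertices C d M | h. h \<in> hyperedges C d \<and> h \<inter> decoding_vertices C d M \<noteq> {}}"

definition edge_boundary :: "'v set \<Rightarrow> 'v set set \<Rightarrow> 'v set" where
  "edge_boundary V c = {v \<in> V. odd (card {e \<in> c. v \<in> e})}"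

definition minimum_weight_matching :: "'v set \<Rightarrow> 'v set set \<Rightarrow> 'v set \<Rightarrow> 'v set set \<Rightarrow> bool" where
  "minimum_weight_matching V E D c \<longleftrightarrow>
     c \<subseteq> E \<and> edge_boundary V c = D \<and>
     (\<forall>c'. c' \<subseteq> E \<and> edge_boundary V c' = D \<longrightarrow> card c \<le> card c')"

definition predicts_flip :: "'q circuit \<Rightarrow> nat \<Rightarrow> (int \<times> 'q) set \<Rightarrow> 'q detector set set \<Rightarrow> bool" where
  "predicts_flip C d M c \<longleftrightarrow> odd (card (c \<inter> observing_edges C d M))"


section \<open>Sanity checks\<close>

text \<open>
  The sets whose cardinalities are used above are finite, so that \<^const>\<open>card\<close> counts properly.
\<close>

lemma finite_layers:
  assumes "bare_circuit C"
  shows "finite {(t, j). C t j \<noteq> Inactive}"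
proof -
  have "finite {t. C t j \<noteq> Inactive}" for j
  proof (cases "j \<in> qubits C")
    case True
    then obtain r m where "\<forall>t. t < r \<or> m < t \<longrightarrow> C t j = Inactive"
      using assms unfolding bare_circuit_def by blast
    then have "{t. C t j \<noteq> Inactive} \<subseteq> {r..m}" by force
    then show ?thesis by (rule finite_subset) simp
  next
    case False
    then have "{t. C t j \<noteq> Inactive} = {}" by (auto simp: qubits_def)
    then show ?thesis by (metis finite.emptyI)
  qed
  then have "finite (SIGMA j:qubits C. {t. C t j \<noteq> Inactive})"
    using assms by (intro finite_SigmaI) (auto simp: bare_circuit_def)
  then have "finite (prod.swap ` (SIGMA j:qubits C. {t. C t j \<noteq> Inactive}))" by simp
  moreover have "{(t, j). C t j \<noteq> Inactive}
      \<subseteq> prod.swap ` (SIGMA j:qubits C. {t. C t j \<noteq> Inactive})"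
    by (force simp: qubits_def image_iff)
  ultimately show ?thesis by (rule finite_subset[rotated])
qed

lemma finite_measurements: "bare_circuit C \<Longrightarrow> finite (measurements C)"
  by (rule finite_subset[OF _ finite_layers]) (auto simp: measurements_def)

lemma finite_locations:
  assumes "bare_circuit C"
  shows "finite (locations C)"
proof -
  have "locations C \<subseteq> (\<lambda>(t, j). (t + 1, j)) ` {(t, j). C t j \<noteq> Inactive}"
  proof
    fix l assume l: "l \<in> locations C"
    obtain t j where tj: "l = (t, j)" by (cases l)
    then have "(t - 1, j) \<in> {(t, j). C t j \<noteq> Inactive}"
      using l by (auto simp: locations_def)
    then show "l \<in> (\<lambda>(t, j). (t + 1, j)) ` {(t, j). C t j \<noteq> Inactive}"
      unfolding tj by (rule rev_image_eqI) simp
  qed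
  then show ?thesis using finite_layers[OF assms] by (metis finite_imageI finite_subset)
qed

lemma finite_sites: "finite (data_sites d)" "finite (checks d)"
  by (rule finite_subset[of _ "sites d"]; auto simp: sites_def data_sites_def checks_def)+

lemma finite_basic_faults:
  assumes "bare_circuit C"
  shows "finite (basic_faults C d)"
proof -
  let ?A = "{(t, j). C t j \<noteq> Inactive}"
  have "outcomes C d \<subseteq> (\<lambda>((t, j), s). CheckOutcome t j s) ` (?A \<times> checks d) \<union>
      (\<lambda>((t, j), s). DataOutcome t j s) ` (?A \<times> data_sites d)"
    by (force simp: outcomes_def)
  then have out: "finite (outcomes C d)"
    by (rule finite_subset) (simp add: finite_layers[OF assms] finite_sites)
  have "basic_faults C d \<subseteq> (\<lambda>((t, j), s). XFault t j s) ` (locations C \<times> data_sites d) \<union>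
      (\<lambda>((t, j), s). ZFault t j s) ` (locations C \<times> data_sites d) \<union> OutcomeFlip ` outcomes C d"
    by (force simp: basic_faults_def)
  then show ?thesis
    by (rule finite_subset) (simp add: finite_locations[OF assms] finite_sites out)
qed

lemma finite_decoding_edges:
  assumes "bare_circuit C"
  shows "finite (decoding_edges C d M)"
proof -
  have "decoding_edges C d M \<subseteq> (\<lambda>f. hyperedge C d f \<inter> decoding_vertices C d M) ` basic_faults C d"
    by (auto simp: decoding_edges_def hyperedges_def)
  then show ?thesis using finite_basic_faults[OF assms] by (metis finite_imageI finite_subset)
qed

text \<open>
  Although defined by iteration from the last measurement in \<open>M\<close>, the observing region satisfies
  the backward propagation rule at every layer.
\<close>

lemma observing_region_back_layer:
  assumes "finite M"
  shows "observing_region C M t = back_layer C M t (observing_region C M (t + 1))"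
proof (cases "t \<le> last_time M")
  case True
  then have "nat (last_time M + 1 - t) = Suc (nat (last_time M + 1 - (t + 1)))"
    and "last_time M - int (nat (last_time M + 1 - (t + 1))) = t"
    by auto
  then show ?thesis by (simp add: observing_region_def)
next
  case False
  have "(t, j) \<notin> M" for j
  proof
    assume "(t, j) \<in> M"
    then have "t \<le> last_time M"
      unfolding last_time_def using assms by (intro Max_ge) force+
    then show False using False by simp
  qed
  then have "back_layer C M t (\<lambda>j. PI) = (\<lambda>j. PI)"
    by (auto simp: fun_eq_iff back_layer_def conj_H_def conj_S_def conj_CNOT_control_def
        conj_CNOT_target_def split: operation.split gate.split)
  then show ?thesis using False by (simp add: observing_region_def)
qed

end

theory Submission
  imports Defs "HOL-Library.Z2"
begin

text \<open>
  Besides the boundary strings, a logical \<open>Z\<close> is represented by each of the \<open>d\<close> vertical lines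
  \<open>x = k\<close>, and a logical \<open>X\<close> by each of the \<open>d\<close> horizontal lines \<open>y = k\<close>. Reading out \<open>O\<close> along the
  lines of index \<open>k\<close> instead of \<open>d - 1\<close> changes its raw outcome exactly by the detectors in the strip
  between them, over all space-time locations in the observing region; reliability guarantees that
  these detectors exist, and all of them are vertices of the decoding subgraph. Hence if two sets of
  faults have the same syndrome there but differ on \<open>O\<close>, they differ on all \<open>d\<close> shifted readouts.
  On the other hand, a basic fault flips at most one of the shifted readouts, because all gates map
  the lines of index \<open>k\<close> to lines of the same index, and \<open>Y\<close> is not a basic fault. So the two sets contain at least \<open>d\<close> faults
  together, which is impossible for an error of weight below \<open>d/2\<close> and a minimum-weight correction.
\<close>

text \<open>These simplification rules would hide sums in \<^typ>\<open>bit\<close> from the rules about sums.\<close>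

declare add_bit_eq_xor [simp del] mult_bit_eq_and [simp del] sum_of_bool_eq [simp del]

section \<open>Parities as sums over the two-element field\<close>

lemma bit_double [simp]: "x + x = (0::bit)" "x + (x + y) = (y::bit)"
  by (cases x; simp)+

lemma bit_add_eq_0_iff [simp]: "x + y = (0::bit) \<longleftrightarrow> x = y"
  by (cases x; cases y) simp_all

lemma of_nat_bit: "of_nat n = (of_bool (odd n) :: bit)"
  by (induction n) auto

text \<open>Turns parity statements into sums in \<open>bit\<close>, where exchanging the order of
  summation and cancelling equal terms replace case distinctions on \<open>odd\<close>.\<close>

lemma of_bool_odd_card:
  assumes "finite A"
  shows "(of_bool (odd (card {x \<in> A. P x})) :: bit) = (\<Sum>x\<in>A. of_bool (P x))"
  using assms by (simp add: sum_of_bool_eq of_nat_bit Int_def)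

lemma sum_of_bool_mem_swap:
  assumes "finite A" "finite B"
  shows "(\<Sum>x\<in>A. of_bool (x \<in> B)) = (\<Sum>x\<in>B. of_bool (x \<in> A) :: 'b::semiring_1)"
proof -
  have "(\<Sum>x\<in>A. of_bool (x \<in> B)) = (\<Sum>x\<in>A \<inter> B. 1 :: 'b)"
    using assms by (intro sum.mono_neutral_cong_right) auto
  also have "\<dots> = (\<Sum>x\<in>B. of_bool (x \<in> A))"
    using assms by (intro sum.mono_neutral_cong_left) auto
  finally show ?thesis .
qed

section \<open>Shifted logical lines, strips and reflection\<close>

text \<open>The column x = k or the row y = k in doubled coordinates. As \<open>2 * k\<close> is
  even, only data qubits with integer coordinates lie on lines.\<close>

fun line :: "nat \<Rightarrow> int \<Rightarrow> basis \<Rightarrow> site set" where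
  "line d k ZBasis = {s \<in> data_sites d. fst s = 2 * k}"
| "line d k XBasis = {s \<in> data_sites d. snd s = 2 * k}"

lemma line_subset: "line d k b \<subseteq> data_sites d"
  by (cases b) auto

lemma line_unique: "s \<in> line d k b \<Longrightarrow> s \<in> line d l b \<Longrightarrow> k = l"
  by (cases b) auto

lemma logical_support_eq_line:
  assumes "d \<ge> 1"
  shows "logical_support d b = line d (int d - 1) b"
  using assms by (cases b) (auto simp: data_sites_def sites_def elim!: evenE)

text \<open>The logical lift of a Pauli, with its two strings moved to index \<open>k\<close>. Row
  and column share only the diagonal site, so a lifted Y acts as Y there and as X or Z on the rest
  of the lines.\<close>

definition lift :: "nat \<Rightarrow> int \<Rightarrow> pauli \<Rightarrow> site \<Rightarrow> pauli" where
  "lift d k p s = (fst p \<and> s \<in> line d k XBasis, snd p \<and> s \<in> line d k ZBasis)"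

text \<open>The criterion for detectors of the type of \<open>s\<close> to belong to the decoding
  subgraph: the Pauli has the component of the same type as the check, as opposed to anticommuting
  with it.\<close>

definition contains_type :: "pauli \<Rightarrow> site \<Rightarrow> bool" where
  "contains_type p s \<longleftrightarrow> (if is_X_check s then fst p else snd p)"

text \<open>Selects the checks on the side of line \<open>k\<close> facing the boundary string of
  index \<open>d - 1\<close>. For \<open>0 \<le> k < d\<close>, those of one type multiply to line
  \<open>k\<close> times line \<open>d - 1\<close>.\<close>

definition beyond :: "int \<Rightarrow> site \<Rightarrow> bool" where
  "beyond k s \<longleftrightarrow> 2 * k < (if is_X_check s then snd s else fst s)"

definition shifted_outcome :: "'q circuit \<Rightarrow> nat \<Rightarrow> (int \<times> 'q) set \<Rightarrow> int \<Rightarrow> 'q outcome set" where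
  "shifted_outcome C d M k =
     {DataOutcome t j s | t j s b. (t, j) \<in> M \<and> C t j = Measure b \<and> s \<in> line d k b}"

text \<open>Described by region and geometry alone. That all these triples are detectors is the
  content of \<open>strip_subset\<close>, through which reliability enters.\<close>

definition strip_detectors :: "'q circuit \<Rightarrow> nat \<Rightarrow> (int \<times> 'q) set \<Rightarrow> int \<Rightarrow> 'q detector set" where
  "strip_detectors C d M k =
     {(t, j, s). s \<in> checks d \<and> contains_type (observing_region C M t j) s \<and> beyond k s}"

lemma reflect_reflect [simp]: "reflect (reflect s) = s"
  by (simp add: reflect_def)

lemma reflect_simps [simp]:
  "is_X_check (reflect s) = is_Z_check s" "is_Z_check (reflect s) = is_X_check s"
  "reflect s \<in> checks d \<longleftrightarrow> s \<in> checks d" "reflect s \<in> data_sites d \<longleftrightarrow> s \<in> data_sites d"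
  "reflect s \<in> line d k ZBasis \<longleftrightarrow> s \<in> line d k XBasis"
  "reflect s \<in> line d k XBasis \<longleftrightarrow> s \<in> line d k ZBasis"
  by (auto simp: reflect_def is_X_check_def is_Z_check_def checks_def data_sites_def sites_def
      split_beta mem_Times_iff)

declare line.simps [simp del]

lemma check_type: "s \<in> checks d \<Longrightarrow> is_Z_check s \<longleftrightarrow> \<not> is_X_check s"
  by (auto simp: checks_def is_X_check_def is_Z_check_def)

lemma bare_circuit_CNOT:
  "bare_circuit C \<Longrightarrow> C t j = Gate (Control k) \<longleftrightarrow> C t k = Gate (Target j)"
  by (simp add: bare_circuit_def)

lemma anticommute_check_pauli:
  "anticommute p (check_pauli s) \<longleftrightarrow> (if is_X_check s then snd p else fst p)"
  by (simp add: anticommute_def check_pauli_def)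

lemma not_anticommute_PI [simp]: "\<not> anticommute PI q" "\<not> anticommute p PI"
  by (simp_all add: anticommute_def)

lemma lift_PI [simp]: "lift d k PI s = PI"
  by (simp add: lift_def)

lemma check_flipped_single:
  assumes "q \<in> check_support d s"
    and "\<And>q'. anticommute (E j q') (check_pauli s) \<longleftrightarrow> q' = q"
  shows "check_flipped d E j s"
proof -
  have "{q' \<in> check_support d s. anticommute (E j q') (check_pauli s)} = {q}" using assms by auto
  then show ?thesis by (simp add: check_flipped_def)
qed

lemma not_check_flipped:
  assumes "\<And>q'. \<not> anticommute (E j q') (check_pauli s)"
  shows "\<not> check_flipped d E j s"
  using assms by (simp add: check_flipped_def)

lemma reflect_check_support: "q \<in> check_support d s \<Longrightarrow> reflect q \<in> check_support d (reflect s)"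
  by (auto simp: check_support_def reflect_def data_sites_def sites_def split: prod.splits)

lemma reflect_eq_iff: "reflect s = q \<longleftrightarrow> s = reflect q"
  by (auto simp: reflect_def)

lemma sum_reflect: "(\<Sum>s\<in>data_sites d. f (reflect s)) = (\<Sum>s\<in>data_sites d. f s)"
  by (rule sum.reindex_bij_witness[of _ reflect reflect]) auto

lemma sum_of_bool_filter:
  "finite A \<Longrightarrow> (\<Sum>x\<in>A. of_bool (P x) :: 'b::semiring_1) = (\<Sum>x\<in>{x \<in> A. P x}. 1)"
  by (rule sum.mono_neutral_cong_right) auto

lemma check_support_subset: "check_support d w \<subseteq> data_sites d"
  by (auto simp: check_support_def split: prod.splits)

lemma single_error_components [simp]:
  "fst (single_error p j s j' s') \<longleftrightarrow> j' = j \<and> s' = s \<and> fst p"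
  "snd (single_error p j s j' s') \<longleftrightarrow> j' = j \<and> s' = s \<and> snd p"
  by (auto simp: single_error_def)

lemma basic_faultsI:
  assumes "(t, j) \<in> locations C" "s \<in> data_sites d"
  shows "XFault t j s \<in> basic_faults C d" "ZFault t j s \<in> basic_faults C d"
  using assms unfolding basic_faults_def by blast+

section \<open>Support of the observing region and existence of its detectors\<close>

locale encoded_observable =
  fixes C :: "'q circuit" and d :: nat and M :: "(int \<times> 'q) set"
  assumes distance: "d \<ge> 2" and bare: "bare_circuit C"
    and observable: "observable C M" and reliable: "reliable C M"
begin

abbreviation "region \<equiv> observing_region C M"

lemma finite_M: "finite M"
  using observable finite_measurements[OF bare] finite_subset by (auto simp: observable_def)

lemma region_step:
  "region t j = (case C t j of
        Inactive \<Rightarrow> PI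
      | Reset k \<Rightarrow> PI
      | Measure b \<Rightarrow> (if (t, j) \<in> M then basis_pauli b else PI)
      | Gate g \<Rightarrow>
          (case g of
             GateI \<Rightarrow> region (t + 1) j
           | GateH \<Rightarrow> conj_H (region (t + 1) j)
           | GateS \<Rightarrow> conj_S (region (t + 1) j)
           | Control k \<Rightarrow> conj_CNOT_control (region (t + 1) j) (region (t + 1) k)
           | Target k \<Rightarrow> conj_CNOT_target (region (t + 1) j) (region (t + 1) k)))"
  using fun_cong[OF observing_region_back_layer[OF finite_M, of C t], of j]
  by (simp add: back_layer_def)

lemma CNOT_partner:
  "C t j = Gate (Control k) \<Longrightarrow> C t k = Gate (Target j)"
  "C t k = Gate (Target j) \<Longrightarrow> C t j = Gate (Control k)"
  using bare_circuit_CNOT[OF bare] by blast+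

text \<open>A nontrivial Pauli arises only before a gate or a measurement in \<open>M\<close>. Such
  a layer comes strictly after the reset of the qubit and no later than its measurement, so the
  layer before it is a reset or a gate.\<close>

lemma region_support:
  assumes "region t j \<noteq> PI"
  shows "(t, j) \<in> locations C" and "(\<exists>g. C t j = Gate g) \<or> (\<exists>b. C t j = Measure b \<and> region t j = basis_pauli b)"
proof -
  show *: "(\<exists>g. C t j = Gate g) \<or> (\<exists>b. C t j = Measure b \<and> region t j = basis_pauli b)"
    using assms region_step[of t j] by (auto split: operation.splits if_splits)
  then have "j \<in> qubits C" unfolding qubits_def mem_Collect_eq
    by (metis operation.distinct(3,5))
  then obtain r m where rm: "r < m" "\<exists>k. C r j = Reset k"
      "\<forall>t. r < t \<and> t < m \<longrightarrow> (\<exists>g. C t j = Gate g)" "\<exists>b. C m j = Measure b"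
      "\<forall>t. t < r \<or> m < t \<longrightarrow> C t j = Inactive"
    using bare unfolding bare_circuit_def by blast
  have "r < t" "t \<le> m" using * rm(2,5) by (metis linorder_less_linear operation.distinct)
      (use * rm(5) in \<open>metis linorder_not_le operation.distinct\<close>)
  then have "t - 1 = r \<or> (r < t - 1 \<and> t - 1 < m)" by linarith
  then show "(t, j) \<in> locations C" using rm by (auto simp: locations_def)
qed

text \<open>Reliability is tested on the stabilizer of one single reset. Its region lives at one
  location, so the parity of anticommuting locations is just anticommutation there.\<close>

lemma region_after_reset:
  assumes "(t, j) \<in> locations C"
  shows "C (t - 1) j = Reset Reset0 \<Longrightarrow> \<not> fst (region t j)"
    and "C (t - 1) j = Reset ResetPlus \<Longrightarrow> \<not> snd (region t j)"
proof -
  have *: "{(u, i). (u, i) \<in> locations C \<and> anticommute (region u i) (reset_region C {(t - 1, j)} u i)}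
      = (if anticommute (region t j) p then {(t, j)} else {})"
    if "p = (if C (t - 1) j = Reset Reset0 then PZ else if C (t - 1) j = Reset ResetPlus then PX else PI)" for p
    using assms that by (auto simp: reset_region_def anticommute_def split: if_splits)
  have "\<not> region_anticommute C region (reset_region C {(t - 1, j)})"
    if "C (t - 1) j = Reset Reset0 \<or> C (t - 1) j = Reset ResetPlus"
    using reliable that by (auto simp: reliable_def fragile_def stabilizer_resets_def)
  then show "C (t - 1) j = Reset Reset0 \<Longrightarrow> \<not> fst (region t j)"
    and "C (t - 1) j = Reset ResetPlus \<Longrightarrow> \<not> snd (region t j)"
    unfolding region_anticommute_def *[OF refl] by (auto simp: anticommute_def split: if_splits)
qed

text \<open>The detectors absent at a location are of a type that the region cannot contain: after a
  reset by reliability, before a measurement because the region there is the Pauli of the measured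
  basis.\<close>

lemma detector_if_contains_type:
  assumes "s \<in> checks d" "contains_type (region t j) s"
  shows "(t, j, s) \<in> detectors C d"
proof -
  have "region t j \<noteq> PI" using assms(2) by (auto simp: contains_type_def split: if_splits)
  note sup = region_support[OF this]
  then show ?thesis
    using region_after_reset[OF sup(1)] assms check_type[OF assms(1)]
    by (auto simp: detectors_def contains_type_def split: if_splits)
qed

section \<open>Outcomes contained in the detectors of a strip, modulo 2\<close>

lemma strip_subset: "strip_detectors C d M k \<subseteq> detectors C d"
  using detector_if_contains_type by (auto simp: strip_detectors_def)

lemma finite_detectors: "finite (detectors C d)"
  by (rule finite_subset[of _ "(\<lambda>((t, j), s). (t, j, s)) ` (locations C \<times> checks d)"])
    (force simp: detectors_def, simp add: finite_locations[OF bare] finite_sites)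

lemma finite_strip: "finite (strip_detectors C d M k)"
  using finite_subset[OF strip_subset finite_detectors] .

lemma strip_iff:
  "(t, j, s) \<in> strip_detectors C d M k \<longleftrightarrow>
     s \<in> checks d \<and> contains_type (region t j) s \<and> beyond k s"
  by (simp add: strip_detectors_def)

lemma finite_shifted_outcome: "finite (shifted_outcome C d M k)"
proof -
  have "shifted_outcome C d M k \<subseteq> (\<lambda>((t, j), s). DataOutcome t j s) ` (M \<times> data_sites d)"
    using line_subset by (force simp: shifted_outcome_def)
  then show ?thesis
    by (rule finite_subset) (simp add: finite_M finite_sites)
qed

lemma raw_outcome_eq_shifted: "raw_outcome C d M = shifted_outcome C d M (int d - 1)"
  using distance by (auto simp: raw_outcome_def shifted_outcome_def logical_support_eq_line)

text \<open>Reduces a sum over the whole strip to the few candidates \<open>X\<close> that contain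
  one given outcome; candidates outside the strip contribute zero.\<close>

lemma sum_strip:
  assumes "finite X" "\<And>v. v \<in> strip_detectors C d M k \<Longrightarrow> P v \<longleftrightarrow> v \<in> X"
  shows "(\<Sum>v\<in>strip_detectors C d M k. of_bool (P v) :: bit)
    = (\<Sum>v\<in>X. of_bool (v \<in> strip_detectors C d M k))"
  using assms sum_of_bool_mem_swap[OF finite_strip assms(1)] by (simp cong: sum.cong)

text \<open>Reflection exchanges the check type and the coordinates together, so the same number is
  compared with \<open>2 * k\<close>. This is why H and S preserve the index of a strip.\<close>

lemma reflect_beyond: "s \<in> checks d \<Longrightarrow> beyond k (reflect s) \<longleftrightarrow> beyond k s"
  using check_type[of s d] by (auto simp: beyond_def) (auto simp: reflect_def)

text \<open>A check outcome occurs in one detector after its layer and in one or two before it. The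
  region is propagated backwards by the rule dual to the definition of detectors, so an even number
  of these lie in the strip.\<close>

lemma strip_CheckOutcome:
  "(\<Sum>v\<in>strip_detectors C d M k. of_bool (CheckOutcome t j s \<in> detector_outcomes C d v) :: bit) = 0"
proof (cases "s \<in> checks d \<and> (\<exists>g. C t j = Gate g)")
  case False
  have "CheckOutcome t j s \<notin> detector_outcomes C d v" if "v \<in> strip_detectors C d M k" for v
    using that False reflect_simps(3)
    by (cases v) (auto simp: strip_iff earlier_outcomes_def later_outcomes_def dest: CNOT_partner
        split: operation.splits gate.splits if_splits)
  then show ?thesis by simp
next
  case True
  then obtain g where g: "C t j = Gate g" and s: "s \<in> checks d" by auto
  note ct = check_type[OF s] and rs = region_step[of t j]
  \<comment> \<open>The detectors at time \<open>t\<close> having this outcome as a later outcome,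
    found by reading \<open>later_outcomes\<close> backwards. Hence the two-element cases carry the
    type opposite to those in \<open>later_outcomes\<close>.\<close>
  define X where "X = (case g of GateI \<Rightarrow> {(t, j, s)} | GateH \<Rightarrow> {(t, j, reflect s)}
     | GateS \<Rightarrow> (if is_Z_check s then {(t, j, s), (t, j, reflect s)} else {(t, j, s)})
     | Control k \<Rightarrow> (if is_Z_check s then {(t, j, s), (t, k, s)} else {(t, j, s)})
     | Target k \<Rightarrow> (if is_X_check s then {(t, j, s), (t, k, s)} else {(t, j, s)}))"
  have X: "CheckOutcome t j s \<in> detector_outcomes C d v \<longleftrightarrow> v \<in> insert (t + 1, j, s) X"
    if "v \<in> strip_detectors C d M k" for v
  proof -
    obtain t' j' s' where v: "v = (t', j', s')" by (cases v)
    have s': "s' \<in> checks d" using that v by (simp add: strip_iff)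
    note ct' = check_type[OF this]
    have 1: "CheckOutcome t j s \<in> earlier_outcomes C t' j' s' \<longleftrightarrow> v = (t + 1, j, s)"
      using g v by (auto simp: earlier_outcomes_def)
    have partner: "C t i = Gate (Target j) \<longleftrightarrow> g = Control i" "C t i = Gate (Control j) \<longleftrightarrow> g = Target i" for i
      using g bare_circuit_CNOT[OF bare] by (metis gate.inject operation.inject(2))+
    have "CheckOutcome t j s \<in> later_outcomes C d t j' s' \<longleftrightarrow> (t, j', s') \<in> X"
    proof (cases "j' = j")
      case True
      then show ?thesis using g ct ct'
        by (cases g) (auto simp: later_outcomes_def X_def)
    next
      case False
      have "CheckOutcome t j s \<in> later_outcomes C d t j' s' \<longleftrightarrow>
          s' = s \<and> (is_X_check s \<and> C t j' = Gate (Control j) \<or> is_Z_check s \<and> C t j' = Gate (Target j))"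
        using False ct'
        by (auto simp: later_outcomes_def split: operation.splits gate.splits if_splits)
      then show ?thesis
        using False ct unfolding partner X_def by (cases g) auto
    qed
    moreover have "CheckOutcome t j s \<notin> later_outcomes C d t' j' s'" "v \<notin> X" if "t' \<noteq> t"
      using that v g
      by (auto simp: later_outcomes_def X_def split: operation.splits gate.splits if_splits)
    ultimately have 2: "CheckOutcome t j s \<in> later_outcomes C d t' j' s' \<longleftrightarrow> v \<in> X"
      using v by (cases "t' = t") auto
    show ?thesis using 1 2 v by simp
  qed
  have "finite (insert (t + 1, j, s) X)" by (auto simp: X_def split: gate.split)
  then have sum: "(\<Sum>v\<in>strip_detectors C d M k. of_bool (CheckOutcome t j s \<in> detector_outcomes C d v) :: bit)
    = (\<Sum>v\<in>insert (t + 1, j, s) X. of_bool (v \<in> strip_detectors C d M k))"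
    using X by (rule sum_strip)
  \<comment> \<open>Reflection swaps the types, so no check is fixed by it and the two detectors in
    the S case are distinct.\<close>
  have ne: "reflect s \<noteq> s" using ct by (metis reflect_simps(1))
  show ?thesis
  proof (cases g)
    case (Control i)
    then have i: "C t i = Gate (Target j)" using g CNOT_partner(1) by blast
    then have "i \<noteq> j" using g Control by auto
    then show ?thesis
      unfolding sum using Control s ct rs g i region_step[of t i]
      by (auto simp: X_def strip_iff contains_type_def conj_CNOT_control_def conj_CNOT_target_def)
  next
    case (Target i)
    then have i: "C t i = Gate (Control j)" using g CNOT_partner(2) by blast
    then have "i \<noteq> j" using g Target by auto
    then show ?thesis
      unfolding sum using Target s ct rs g i region_step[of t i]
      by (auto simp: X_def strip_iff contains_type_def conj_CNOT_control_def conj_CNOT_target_def)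
  qed (use s ct rs g ne in \<open>auto simp: sum X_def strip_iff contains_type_def conj_H_def conj_S_def reflect_beyond\<close>)
qed

text \<open>The checks beyond line \<open>k\<close> cover every data qubit an even number of times,
  except those on line \<open>k\<close> and on line \<open>d - 1\<close>, which cancel each other if
  the two lines coincide.\<close>

lemma strip_DataOutcome:
  assumes k: "0 \<le> k" "k < int d"
  shows "(\<Sum>v\<in>strip_detectors C d M k. of_bool (DataOutcome t j s \<in> detector_outcomes C d v) :: bit)
     = of_bool (DataOutcome t j s \<in> shifted_outcome C d M k)
       + of_bool (DataOutcome t j s \<in> shifted_outcome C d M (int d - 1))"
proof (cases "s \<in> data_sites d \<and> (\<exists>b. C t j = Measure b)")
  case False
  have "DataOutcome t j s \<notin> detector_outcomes C d v" for v
    using False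
    by (cases v) (auto simp: earlier_outcomes_def later_outcomes_def check_support_def
        split: operation.splits gate.splits if_splits)
  moreover have "DataOutcome t j s \<notin> shifted_outcome C d M l" for l
    using False line_subset by (fastforce simp: shifted_outcome_def)
  ultimately show ?thesis by simp
next
  case True
  then obtain b where b: "C t j = Measure b" and s: "s \<in> data_sites d" by auto
  obtain x y where xy: "s = (x, y)" by (cases s)
  define X where "X = {(t, j, (x - 1, y)), (t, j, (x + 1, y)), (t, j, (x, y - 1)), (t, j, (x, y + 1))}"
  have X: "DataOutcome t j s \<in> detector_outcomes C d v \<longleftrightarrow> v \<in> X" for v
    using b s
    by (cases v) (auto simp: X_def xy earlier_outcomes_def later_outcomes_def check_support_def
        split: operation.splits gate.splits if_splits)
  have sh: "DataOutcome t j s \<in> shifted_outcome C d M l \<longleftrightarrow> (t, j) \<in> M \<and> s \<in> line d l b" for l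
    using b xy by (auto simp: shifted_outcome_def)
  have bounds: "0 \<le> x" "0 \<le> y" "x \<le> 2 * (int d - 1)" "y \<le> 2 * (int d - 1)" "even (x + y)"
    using s by (auto simp: xy data_sites_def sites_def)
  have sum: "(\<Sum>v\<in>strip_detectors C d M k. of_bool (DataOutcome t j s \<in> detector_outcomes C d v) :: bit)
     = (\<Sum>v\<in>X. of_bool (v \<in> strip_detectors C d M k))"
    using X by (intro sum_strip) (auto simp: X_def)
  note rs = region_step[of t j]
  show ?thesis
  proof (cases "(t, j) \<in> M")
    case False
    then show ?thesis unfolding sum sh using rs b
      by (simp add: X_def strip_iff contains_type_def)
  next
    case True
    then show ?thesis
    proof (cases b)
      case ZBasis
      \<comment> \<open>For even \<open>x\<close> the adjacent Z-checks are the horizontal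
        neighbours, and the strip separates them only at line \<open>k\<close> or cuts one off at
        the boundary. For odd \<open>x\<close> they are the vertical neighbours, both in the strip
        or both outside.\<close>
      then show ?thesis unfolding sum sh using True rs b bounds k
        by (cases "even x"; auto simp: X_def strip_iff contains_type_def beyond_def checks_def is_X_check_def is_Z_check_def
            sites_def data_sites_def xy of_bool_def line.simps elim!: evenE oddE; presburger)
    next
      case XBasis
      then show ?thesis unfolding sum sh using True rs b bounds k
        by (cases "even x"; auto simp: X_def strip_iff contains_type_def beyond_def checks_def is_X_check_def is_Z_check_def
            sites_def data_sites_def xy of_bool_def line.simps elim!: evenE oddE; presburger)
    qed
  qed
qed

section \<open>Shifted readouts expressed through detectors\<close>

lemma location_qubit: "(t, j) \<in> locations C \<Longrightarrow> j \<in> qubits C"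
  unfolding locations_def qubits_def by (auto intro: exI[of _ "t - 1"])

lemma finite_qubits: "finite (qubits C)"
  using bare by (simp add: bare_circuit_def)

lemma finite_detector_outcomes: "finite (detector_outcomes C d v)"
  by (cases v) (auto simp: earlier_outcomes_def later_outcomes_def check_support_def
      split: operation.split gate.split)

definition flips_shifted :: "int \<Rightarrow> 'q fault \<Rightarrow> bool" where
  "flips_shifted k f \<longleftrightarrow> odd (card {m \<in> shifted_outcome C d M k. fault_flips_outcome C d f m})"

lemma flips_observable_eq_shifted: "fault_flips_observable C d M f = flips_shifted (int d - 1) f"
  by (simp add: fault_flips_observable_def flips_shifted_def raw_outcome_eq_shifted)

lemma strip_outcome:
  assumes "0 \<le> k" "k < int d"
  shows "(\<Sum>v\<in>strip_detectors C d M k. of_bool (m \<in> detector_outcomes C d v) :: bit)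
     = of_bool (m \<in> shifted_outcome C d M k) + of_bool (m \<in> shifted_outcome C d M (int d - 1))"
proof (cases m)
  case (CheckOutcome t j s)
  then show ?thesis by (simp add: strip_CheckOutcome shifted_outcome_def)
next
  case (DataOutcome t j s)
  then show ?thesis using strip_DataOutcome[OF assms] by simp
qed

text \<open>Double counting of pairs of a strip detector and a flipped outcome in it: by
  \<open>strip_outcome\<close>, only outcomes in exactly one of the readouts \<open>k\<close> and
  \<open>d - 1\<close> survive modulo 2.\<close>

lemma flips_shifted_eq:
  assumes "0 \<le> k" "k < int d"
  shows "(of_bool (flips_shifted k f) :: bit) = of_bool (fault_flips_observable C d M f)
    + (\<Sum>v\<in>strip_detectors C d M k. of_bool (fault_flips_detector C d f v))"
proof -
  let ?S = "strip_detectors C d M k" and ?out = "detector_outcomes C d"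
    and ?sh = "shifted_outcome C d M" and ?l = "int d - 1"
  let ?U = "(\<Union>v\<in>?S. ?out v) \<union> ?sh k \<union> ?sh ?l"
  let ?f = "\<lambda>m. of_bool (fault_flips_outcome C d f m) :: bit"
  have fin: "finite ?U" using finite_strip finite_detector_outcomes finite_shifted_outcome by simp
  have restrict: "of_bool (odd (card {m \<in> B. fault_flips_outcome C d f m}))
      = (\<Sum>m\<in>?U. of_bool (m \<in> B) * ?f m)" if "B \<subseteq> ?U" for B
    using fin that finite_subset[OF that fin] unfolding of_bool_odd_card[OF finite_subset[OF that fin]]
    by (intro sum.mono_neutral_cong_left) auto
  have "(\<Sum>v\<in>?S. of_bool (fault_flips_detector C d f v) :: bit)
      = (\<Sum>v\<in>?S. \<Sum>m\<in>?U. of_bool (m \<in> ?out v) * ?f m)"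
    unfolding fault_flips_detector_def by (intro sum.cong refl restrict) blast
  also have "\<dots> = (\<Sum>m\<in>?U. (\<Sum>v\<in>?S. of_bool (m \<in> ?out v)) * ?f m)"
    unfolding sum_distrib_right by (rule sum.swap)
  also have "\<dots> = (\<Sum>m\<in>?U. of_bool (m \<in> ?sh k) * ?f m) + (\<Sum>m\<in>?U. of_bool (m \<in> ?sh ?l) * ?f m)"
    unfolding strip_outcome[OF assms] by (simp only: distrib_right sum.distrib)
  also have "\<dots> = of_bool (flips_shifted k f) + of_bool (flips_shifted ?l f)"
    unfolding flips_shifted_def by (subst (1 2) restrict) auto
  finally show ?thesis by (simp add: flips_observable_eq_shifted add_ac)
qed

section \<open>Propagation of errors against the lifted observing region\<close>

text \<open>The symplectic product of an error with the lifted region at time \<open>t\<close>. It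
  is conserved by gates, so flips of a readout can be computed where the error occurs, without
  following its spread.\<close>

definition pairing :: "int \<Rightarrow> int \<Rightarrow> 'q error \<Rightarrow> bit" where
  "pairing k t E =
     (\<Sum>j\<in>qubits C. \<Sum>s\<in>data_sites d. of_bool (anticommute (E j s) (lift d k (region t j) s)))"

definition measured :: "int \<Rightarrow> int \<Rightarrow> 'q error \<Rightarrow> 'q \<Rightarrow> site \<Rightarrow> bool" where
  "measured k t E j s \<longleftrightarrow>
     (t, j) \<in> M \<and> (\<exists>b. C t j = Measure b \<and> s \<in> line d k b \<and> anticommute (E j s) (basis_pauli b))"

text \<open>
  The CNOT contributions (\<open>exch\<close> below) occur once at the control and once at the target of
  each CNOT, and cancel in the sum over all qubits.
\<close>

lemma pairing_step:
  "pairing k t E = (\<Sum>j\<in>qubits C. \<Sum>s\<in>data_sites d. of_bool (measured k t E j s))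
     + pairing k (t + 1) (push_layer C t E)"
proof -
  define R where "R = region (t + 1)"
  define E' where "E' = push_layer C t E"
  define before where "before j = (\<Sum>s\<in>data_sites d. of_bool (anticommute (E j s) (lift d k (region t j) s)) :: bit)" for j
  define after where "after j = (\<Sum>s\<in>data_sites d. of_bool (anticommute (E' j s) (lift d k (R j) s)) :: bit)" for j
  define meas where "meas j = (\<Sum>s\<in>data_sites d. of_bool (measured k t E j s) :: bit)" for j
  define exch where "exch j i = (\<Sum>s\<in>data_sites d. of_bool (fst (E j s) \<and> snd (R i) \<and> s \<in> line d k ZBasis)
      + of_bool (snd (E i s) \<and> fst (R j) \<and> s \<in> line d k XBasis) :: bit)" for j i
  define ctrl where "ctrl j i = (if C t j = Gate (Control i) then exch j i else 0)" for j i
  have rs: "region t j = (case C t j of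
        Inactive \<Rightarrow> PI
      | Reset k \<Rightarrow> PI
      | Measure b \<Rightarrow> (if (t, j) \<in> M then basis_pauli b else PI)
      | Gate g \<Rightarrow>
          (case g of
             GateI \<Rightarrow> R j
           | GateH \<Rightarrow> conj_H (R j)
           | GateS \<Rightarrow> conj_S (R j)
           | Control k \<Rightarrow> conj_CNOT_control (R j) (R k)
           | Target k \<Rightarrow> conj_CNOT_target (R j) (R k)))" for j
    unfolding R_def by (rule region_step)
  have qubit: "i \<in> qubits C" if "C t i = Gate g" for i g
    using that by (auto simp: qubits_def intro!: exI[of _ t])
  have step: "before j + after j = meas j + ((\<Sum>i\<in>qubits C. ctrl j i) + (\<Sum>i\<in>qubits C. ctrl i j))"
    for j
  proof (cases "C t j")
    case (Gate g)
    have m: "meas j = 0" by (simp add: meas_def measured_def Gate)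
    have noctrl: "(\<Sum>i\<in>qubits C. ctrl j i) = 0" if "\<forall>i. g \<noteq> Control i"
      using that Gate by (simp add: ctrl_def)
    have notarg: "(\<Sum>i\<in>qubits C. ctrl i j) = 0" if "\<forall>i. g \<noteq> Target i"
      using that Gate CNOT_partner(1)[of t _ j] by (fastforce simp: ctrl_def intro!: sum.neutral)
    show ?thesis
    proof (cases g)
      case GateI
      then show ?thesis using m noctrl notarg Gate rs[of j]
        by (simp add: before_def after_def E'_def push_layer_def)
    next
      \<comment> \<open>Logical H exchanges X with Z and reflects the sites, hence maps row
        \<open>k\<close> to column \<open>k\<close>; the sum is reindexed accordingly.\<close>
      case GateH
      have "after j = (\<Sum>s\<in>data_sites d. of_bool (anticommute (conj_H (E j (reflect s))) (lift d k (R j) (reflect (reflect s)))))"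
        using Gate GateH by (simp add: after_def E'_def push_layer_def)
      also have "\<dots> = (\<Sum>s\<in>data_sites d. of_bool (anticommute (conj_H (E j s)) (lift d k (R j) (reflect s))))"
        by (rule sum_reflect)
      also have "\<dots> = before j"
        unfolding before_def using Gate GateH rs[of j]
        by (intro sum.cong refl) (auto simp: lift_def anticommute_def conj_H_def)
      finally show ?thesis using m noctrl notarg GateH by simp
    next
      case GateS
      \<comment> \<open>The mismatch at \<open>s\<close> caused by the Z component that S adds to
        the region. The CZ on the error side adds the same term at the reflected site, so everything
        cancels after reindexing.\<close>
      define h where "h s = (of_bool (fst (E j s) \<and> fst (R j) \<and> s \<in> line d k ZBasis) :: bit)" for s
      have "before j + after j = (\<Sum>s\<in>data_sites d. h s + h (reflect s))"
        unfolding before_def after_def sum.distrib[symmetric]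
      proof (intro sum.cong refl)
        fix s :: site
        \<comment> \<open>On the diagonal, S acts by the CZ formula with the site as its own
          partner, which unifies the two cases.\<close>
        have "reflect s = s" if "fst s = snd s"
          using that by (simp add: reflect_def prod_eq_iff)
        then have "E' j s = (fst (E j s), snd (E j s) \<noteq> fst (E j (reflect s)))"
          using Gate GateS by (auto simp: E'_def push_layer_def conj_S_def conj_CZ_def)
        then show "of_bool (anticommute (E j s) (lift d k (region t j) s))
            + of_bool (anticommute (E' j s) (lift d k (R j) s)) = h s + h (reflect s)"
          using Gate GateS rs[of j]
          by (auto simp: h_def of_bool_def lift_def anticommute_def conj_S_def)
      qed
      also have "\<dots> = 0" unfolding sum.distrib sum_reflect by simp
      finally show ?thesis using m noctrl notarg GateS by simp
    next
      case (Control i)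
      then have "(\<Sum>i'\<in>qubits C. ctrl j i') = (\<Sum>i'\<in>qubits C. if i' = i then exch j i else 0)"
        using Gate by (intro sum.cong) (auto simp: ctrl_def)
      also have "\<dots> = exch j i"
        using qubit[OF CNOT_partner(1)] Gate Control finite_qubits by (simp add: sum.delta)
      also have "\<dots> = before j + after j"
        unfolding before_def after_def exch_def sum.distrib[symmetric]
        using Gate Control rs[of j]
        by (intro sum.cong refl) (auto simp: E'_def push_layer_def of_bool_def lift_def anticommute_def conj_CNOT_control_def)
      finally show ?thesis using m notarg Control by simp
    next
      case (Target i)
      then have "(\<Sum>i'\<in>qubits C. ctrl i' j) = (\<Sum>i'\<in>qubits C. if i' = i then exch i j else 0)"
        using Gate bare_circuit_CNOT[OF bare] by (intro sum.cong) (auto simp: ctrl_def)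
      also have "\<dots> = exch i j"
        using qubit[OF CNOT_partner(2)] Gate Target finite_qubits by (simp add: sum.delta)
      also have "\<dots> = before j + after j"
        unfolding before_def after_def exch_def sum.distrib[symmetric]
        using Gate Target rs[of j]
        by (intro sum.cong refl) (auto simp: E'_def push_layer_def of_bool_def lift_def anticommute_def conj_CNOT_target_def)
      finally show ?thesis using m noctrl Target by simp
    qed
  next
    case (Measure b)
    have "ctrl i j = 0" for i using Measure CNOT_partner(1)[of t i j] by (auto simp: ctrl_def)
    moreover have "before j = meas j"
      unfolding before_def meas_def using rs[of j] Measure
      by (intro sum.cong refl; cases b) (auto simp: measured_def lift_def anticommute_def)
    ultimately show ?thesis using Measure
      by (simp add: after_def E'_def push_layer_def ctrl_def)
  next
    case Inactive
    have "ctrl i j = 0" for i using Inactive CNOT_partner(1)[of t i j] by (auto simp: ctrl_def)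
    then show ?thesis using rs[of j] Inactive
      by (simp add: before_def after_def meas_def measured_def E'_def push_layer_def ctrl_def)
  next
    case (Reset r)
    have "ctrl i j = 0" for i using Reset CNOT_partner(1)[of t i j] by (auto simp: ctrl_def)
    then show ?thesis using rs[of j] Reset
      by (simp add: before_def after_def meas_def measured_def E'_def push_layer_def ctrl_def)
  qed
  have "(\<Sum>j\<in>qubits C. before j) + (\<Sum>j\<in>qubits C. after j) = (\<Sum>j\<in>qubits C. meas j)
      + ((\<Sum>j\<in>qubits C. \<Sum>i\<in>qubits C. ctrl j i) + (\<Sum>j\<in>qubits C. \<Sum>i\<in>qubits C. ctrl i j))"
    unfolding sum.distrib[symmetric] step ..
  also have "(\<Sum>j\<in>qubits C. \<Sum>i\<in>qubits C. ctrl i j) = (\<Sum>j\<in>qubits C. \<Sum>i\<in>qubits C. ctrl j i)"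
    by (rule sum.swap)
  finally have "(\<Sum>j\<in>qubits C. before j) + (\<Sum>j\<in>qubits C. after j) = (\<Sum>j\<in>qubits C. meas j)"
    by simp
  then have "(\<Sum>j\<in>qubits C. before j) = (\<Sum>j\<in>qubits C. meas j) + (\<Sum>j\<in>qubits C. after j)"
    by (metis add.assoc add.right_neutral bit_double(1))
  then show ?thesis
    by (simp add: pairing_def before_def after_def meas_def R_def E'_def)
qed

lemma pairing_telescope:
  "pairing k t E = (\<Sum>i<n. \<Sum>j\<in>qubits C. \<Sum>s\<in>data_sites d. of_bool (measured k (t + int i) (evolve C t E i) j s))
     + pairing k (t + int n) (evolve C t E n)"
proof (induction n)
  case (Suc n)
  then show ?case using pairing_step[of k "t + int n" "evolve C t E n"] by (simp add: add_ac)
qed simp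

text \<open>Every layer removes from the pairing exactly the flipped outcomes of the readout
  measured in it, and nothing remains after the last measurement.\<close>

lemma error_flips_shifted:
  "(\<Sum>m\<in>shifted_outcome C d M k. of_bool (error_flips C d t E m)) = pairing k t E"
proof -
  \<comment> \<open>Enough layers to pass \<open>last_time M\<close>; truncation by
    \<open>nat\<close> gives 0 for errors that already occur later, and in either case the region at
    \<open>t + int n\<close> is trivial.\<close>
  define n where "n = nat (last_time M + 1 - t)"
  define A where "A = {x \<in> {..<n} \<times> qubits C \<times> data_sites d.
     case x of (i, j, s) \<Rightarrow> measured k (t + int i) (evolve C t E i) j s}"
  let ?h = "\<lambda>(i, j, s). DataOutcome (t + int i) j s :: 'q outcome"
  have "region (t + int n) = (\<lambda>j. PI)"
    by (simp add: observing_region_def n_def)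
  then have "pairing k (t + int n) (evolve C t E n) = 0" by (simp add: pairing_def)
  then have "pairing k t E = (\<Sum>(i, j, s)\<in>{..<n} \<times> qubits C \<times> data_sites d.
      of_bool (measured k (t + int i) (evolve C t E i) j s))"
    using pairing_telescope[of k t E n] by (simp add: sum.cartesian_product)
  also have "\<dots> = (\<Sum>x\<in>A. 1)"
    unfolding A_def split_def by (rule sum_of_bool_filter) (simp add: finite_qubits finite_sites)
  also have "\<dots> = (\<Sum>m\<in>?h ` A. 1)"
    by (subst sum.reindex) (auto simp: inj_on_def)
  also have "?h ` A = {m \<in> shifted_outcome C d M k. error_flips C d t E m}"
  proof (intro equalityI subsetI)
    fix m assume "m \<in> ?h ` A"
    then show "m \<in> {m \<in> shifted_outcome C d M k. error_flips C d t E m}"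
      by (auto simp: A_def measured_def shifted_outcome_def)
  next
    fix m assume "m \<in> {m \<in> shifted_outcome C d M k. error_flips C d t E m}"
    then obtain u j s b where m: "m = DataOutcome u j s" "(u, j) \<in> M" "C u j = Measure b"
        "s \<in> line d k b" "t \<le> u" "anticommute (evolve C t E (nat (u - t)) j s) (basis_pauli b)"
      by (fastforce simp: shifted_outcome_def)
    have "u \<le> last_time M"
      unfolding last_time_def using finite_M m(2) by (intro Max_ge) force+
    moreover have "j \<in> qubits C" unfolding qubits_def using m(3) by (auto intro: exI[of _ u])
    moreover have "s \<in> data_sites d" using m(4) line_subset by blast
    ultimately have "(nat (u - t), j, s) \<in> A"
      using m by (auto simp: A_def n_def measured_def)
    then show "m \<in> ?h ` A" using m by (intro image_eqI[of _ _ "(nat (u - t), j, s)"]) auto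
  qed
  also have "(\<Sum>m\<in>\<dots>. 1) = (\<Sum>m\<in>shifted_outcome C d M k. of_bool (error_flips C d t E m) :: bit)"
    by (rule sum_of_bool_filter[symmetric, OF finite_shifted_outcome])
  finally show ?thesis ..
qed

lemma pairing_single_error:
  assumes "j \<in> qubits C" "s \<in> data_sites d"
  shows "pairing k t (single_error p j s) = of_bool (anticommute p (lift d k (region t j) s))"
proof -
  have "pairing k t (single_error p j s) = (\<Sum>j'\<in>qubits C. \<Sum>s'\<in>data_sites d.
      if j' = j then if s' = s then of_bool (anticommute p (lift d k (region t j) s)) else 0 else 0)"
    unfolding pairing_def by (intro sum.cong refl) (simp add: single_error_def)
  also have "\<dots> = (\<Sum>j'\<in>qubits C. if j' = j then \<Sum>s'\<in>data_sites d.
      if s' = s then of_bool (anticommute p (lift d k (region t j) s)) else 0 else 0)"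
    by (intro sum.cong refl) simp
  also have "\<dots> = of_bool (anticommute p (lift d k (region t j) s))"
    using assms finite_qubits finite_sites by simp
  finally show ?thesis .
qed

lemma single_error_flips_shifted:
  assumes "(t, j) \<in> locations C" "s \<in> data_sites d"
  shows "odd (card {m \<in> shifted_outcome C d M k. error_flips C d t (single_error p j s) m})
    \<longleftrightarrow> anticommute p (lift d k (region t j) s)"
proof -
  have "(of_bool (odd (card {m \<in> shifted_outcome C d M k. error_flips C d t (single_error p j s) m})) :: bit)
      = of_bool (anticommute p (lift d k (region t j) s))"
    using of_bool_odd_card[OF finite_shifted_outcome] error_flips_shifted
      pairing_single_error[OF location_qubit[OF assms(1)] assms(2)] by simp
  then show ?thesis by (simp only: of_bool_eq_iff)
qed

section \<open>A basic fault flips at most one shifted readout\<close>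

lemma flips_shifted_XFault:
  assumes "(t, j) \<in> locations C" "s \<in> data_sites d"
  shows "flips_shifted k (XFault t j s) \<longleftrightarrow> snd (region t j) \<and> s \<in> line d k ZBasis"
  unfolding flips_shifted_def fault_flips_outcome.simps single_error_flips_shifted[OF assms]
  by (auto simp: lift_def anticommute_def)

lemma flips_shifted_ZFault:
  assumes "(t, j) \<in> locations C" "s \<in> data_sites d"
  shows "flips_shifted k (ZFault t j s) \<longleftrightarrow> fst (region t j) \<and> s \<in> line d k XBasis"
  unfolding flips_shifted_def fault_flips_outcome.simps single_error_flips_shifted[OF assms]
  by (auto simp: lift_def anticommute_def)

lemma flips_shifted_OutcomeFlip: "flips_shifted k (OutcomeFlip m) \<longleftrightarrow> m \<in> shifted_outcome C d M k"
proof -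
  have "{m' \<in> shifted_outcome C d M k. m = m'} = (if m \<in> shifted_outcome C d M k then {m} else {})"
    by auto
  then show ?thesis by (simp add: flips_shifted_def)
qed

text \<open>An X fault is seen only by columns, a Z fault only by rows, and a recorded data outcome
  belongs to a single basis; parallel lines are disjoint.\<close>

lemma flips_shifted_unique:
  assumes "f \<in> basic_faults C d" "flips_shifted k f" "flips_shifted l f"
  shows "k = l"
proof (cases f)
  case (OutcomeFlip m)
  then show ?thesis using assms(2,3) line_unique
    by (fastforce simp: flips_shifted_OutcomeFlip shifted_outcome_def)
next
  case (XFault t j s)
  then have "(t, j) \<in> locations C" "s \<in> data_sites d" using assms(1) by (auto simp: basic_faults_def)
  from flips_shifted_XFault[OF this] show ?thesis using assms(2,3) line_unique XFault by blast
next
  case (ZFault t j s)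
  then have "(t, j) \<in> locations C" "s \<in> data_sites d" using assms(1) by (auto simp: basic_faults_def)
  from flips_shifted_ZFault[OF this] show ?thesis using assms(2,3) line_unique ZFault by blast
qed

section \<open>Vertices of the decoding subgraph\<close>

text \<open>The earlier outcome precedes the fault. Of the later ones exactly one flips: where a
  detector has two check outcomes, the fault commutes through the gate without spreading to the
  second check. For data outcomes, only the one at \<open>q\<close> flips.\<close>

lemma adjacent_detector_flipped:
  assumes "(\<exists>g. C t j = Gate g) \<or> (\<exists>b. C t j = Measure b \<and> basis_pauli b = check_pauli w)"
    and w: "w \<in> checks d" and q: "q \<in> check_support d w"
  shows "odd (card {m \<in> detector_outcomes C d (t, j, w).
    error_flips C d t (single_error (if is_X_check w then PZ else PX) j q) m})"
proof -
  define E where "E = (single_error (if is_X_check w then PZ else PX) j q :: 'q error)"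
  define E' where "E' = push_layer C t E"
  let ?O = "detector_outcomes C d (t, j, w)"
  have ct: "is_Z_check w \<longleftrightarrow> \<not> is_X_check w" by (rule check_type[OF w])
  have earlier: "\<not> error_flips C d t E m" if "m \<in> earlier_outcomes C t j w" for m
    using that by (auto simp: earlier_outcomes_def split: if_splits)
  have later: "{m \<in> ?O. error_flips C d t E m} = {m \<in> later_outcomes C d t j w. error_flips C d t E m}"
    using earlier by auto
  have check: "error_flips C d t E (CheckOutcome t i s) \<longleftrightarrow> check_flipped d E' i s" for i s
    by (simp add: E'_def)
  have "\<exists>m. {m \<in> later_outcomes C d t j w. error_flips C d t E m} = {m}"
  proof (cases "C t j")
    case (Measure b)
    then have b: "basis_pauli b = check_pauli w" using assms(1) by simp
    have "{m \<in> later_outcomes C d t j w. error_flips C d t E m} = {DataOutcome t j q}"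
      using q Measure b
      by (auto simp: later_outcomes_def E_def anticommute_check_pauli)
    then show ?thesis by blast
  next
    case (Gate g)
    show ?thesis
    proof (cases g)
      case GateI
      then have "check_flipped d E' j w"
        using q Gate by (intro check_flipped_single[of q])
          (auto simp: E'_def push_layer_def E_def anticommute_check_pauli)
      then have "{m \<in> later_outcomes C d t j w. error_flips C d t E m} = {CheckOutcome t j w}"
        using Gate GateI by (auto simp: later_outcomes_def check simp del: error_flips.simps)
      then show ?thesis by blast
    next
      case GateH
      then have "check_flipped d E' j (reflect w)"
        using reflect_check_support[OF q] Gate ct by (intro check_flipped_single[of "reflect q"])
          (auto simp: E'_def push_layer_def E_def anticommute_check_pauli
            conj_H_def reflect_eq_iff)
      then have "{m \<in> later_outcomes C d t j w. error_flips C d t E m} = {CheckOutcome t j (reflect w)}"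
        using Gate GateH by (auto simp: later_outcomes_def check simp del: error_flips.simps)
      then show ?thesis by blast
    next
      case GateS
      then have "check_flipped d E' j w"
        using q Gate ct by (intro check_flipped_single[of q])
          (auto simp: E'_def push_layer_def E_def anticommute_check_pauli
            conj_S_def conj_CZ_def)
      moreover have "\<not> check_flipped d E' j (reflect w)" if "is_X_check w"
        using GateS Gate ct that by (intro not_check_flipped)
          (auto simp: E'_def push_layer_def E_def anticommute_check_pauli
            conj_S_def conj_CZ_def)
      ultimately have "{m \<in> later_outcomes C d t j w. error_flips C d t E m} = {CheckOutcome t j w}"
        using Gate GateS by (auto simp: later_outcomes_def check simp del: error_flips.simps)
      then show ?thesis by blast
    next
      case (Control i)
      then have i: "C t i = Gate (Target j)" using Gate CNOT_partner(1) by blast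
      then have "i \<noteq> j" using Gate Control by auto
      then have "check_flipped d E' j w"
        using q Gate Control by (intro check_flipped_single[of q])
          (auto simp: E'_def push_layer_def E_def anticommute_check_pauli
            conj_CNOT_control_def)
      moreover have "\<not> check_flipped d E' i w" if "is_X_check w"
        using \<open>i \<noteq> j\<close> i that by (intro not_check_flipped)
          (auto simp: E'_def push_layer_def E_def anticommute_check_pauli
            conj_CNOT_target_def)
      ultimately have "{m \<in> later_outcomes C d t j w. error_flips C d t E m} = {CheckOutcome t j w}"
        using Gate Control by (auto simp: later_outcomes_def check simp del: error_flips.simps)
      then show ?thesis by blast
    next
      case (Target i)
      then have i: "C t i = Gate (Control j)" using Gate CNOT_partner(2) by blast
      then have "i \<noteq> j" using Gate Target by auto
      then have "check_flipped d E' j w"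
        using q Gate Target by (intro check_flipped_single[of q])
          (auto simp: E'_def push_layer_def E_def anticommute_check_pauli
            conj_CNOT_target_def)
      moreover have "\<not> check_flipped d E' i w" if "is_Z_check w"
        using \<open>i \<noteq> j\<close> i that ct by (intro not_check_flipped)
          (auto simp: E'_def push_layer_def E_def anticommute_check_pauli
            conj_CNOT_control_def)
      ultimately have "{m \<in> later_outcomes C d t j w. error_flips C d t E m} = {CheckOutcome t j w}"
        using Gate Target by (auto simp: later_outcomes_def check simp del: error_flips.simps)
      then show ?thesis by blast
    qed
  qed (use assms(1) in auto)
  then show ?thesis unfolding E_def[symmetric] later by auto
qed

text \<open>Decoding vertices are defined through observing hyperedges, so each type present in the
  region requires a fault that flips the observable and touches a detector of this type.\<close>

lemma region_decoding_vertex: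
  assumes "s \<in> checks d" "contains_type (region t j) s"
  shows "(t, j, s) \<in> decoding_vertices C d M"
proof -
  have "region t j \<noteq> PI" using assms(2) by (auto simp: contains_type_def split: if_splits)
  note sup = region_support[OF this]
  \<comment> \<open>The data qubit \<open>q\<close> is an end of the boundary string, and
    \<open>w\<close> is a check next to it of the type of \<open>s\<close>; it lies in the lattice
    because \<open>d \<ge> 2\<close>.\<close>
  define q where "q = (if is_X_check s then (0, 2 * int d - 2) else (2 * int d - 2, 0))"
  define w where "w = (if is_X_check s then (0, 2 * int d - 3) else (2 * int d - 3, 0))"
  define f where "f = (if is_X_check s then ZFault t j q else XFault t j q)"
  have w: "w \<in> checks d" "is_X_check w = is_X_check s" and q: "q \<in> check_support d w"
    using distance
    by (auto simp: q_def w_def checks_def sites_def is_X_check_def is_Z_check_def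
        check_support_def data_sites_def)
  have qd: "q \<in> data_sites d" using q check_support_subset by blast
  have f: "f \<in> basic_faults C d" using basic_faultsI[OF sup(1) qd] by (simp add: f_def)
  have "q \<in> line d (int d - 1) (if is_X_check s then XBasis else ZBasis)"
    using qd by (auto simp: q_def line.simps)
  then have "fault_flips_observable C d M f"
    using assms(2) flips_shifted_XFault[OF sup(1) qd] flips_shifted_ZFault[OF sup(1) qd]
    by (simp add: f_def flips_observable_eq_shifted contains_type_def split: if_splits)
  then have h: "hyperedge C d f \<in> observing_edges C d M" using f by (auto simp: observing_edges_def)
  have "basis_pauli b = check_pauli w" if "region t j = basis_pauli b" for b
    using that assms(2) w(2) by (cases b) (auto simp: contains_type_def check_pauli_def)
  then have "odd (card {m \<in> detector_outcomes C d (t, j, w).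
      error_flips C d t (single_error (if is_X_check w then PZ else PX) j q) m})"
    using sup(2) by (intro adjacent_detector_flipped w q) blast
  then have "fault_flips_detector C d f (t, j, w)"
    by (simp add: fault_flips_detector_def f_def w(2) split: if_splits)
  moreover have "(t, j, w) \<in> detectors C d"
    using detector_if_contains_type[OF w(1)] assms(2) w(2) by (simp add: contains_type_def)
  ultimately have "(t, j, w) \<in> hyperedge C d f" by (simp add: hyperedge_def)
  moreover have "same_kind (t, j, s) (t, j, w)" using w(2) by simp
  ultimately show ?thesis
    using h detector_if_contains_type[OF assms] unfolding decoding_vertices_def by blast
qed

lemma strip_subset_decoding_vertices: "strip_detectors C d M k \<subseteq> decoding_vertices C d M"
  using region_decoding_vertex by (auto simp: strip_detectors_def)

lemma observing_edge_subset:
  assumes "h \<in> observing_edges C d M"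
  shows "h \<subseteq> decoding_vertices C d M"
proof
  fix v assume "v \<in> h"
  moreover have "same_kind v v" by (cases v) simp
  moreover have "h \<subseteq> detectors C d" using assms by (auto simp: observing_edges_def hyperedge_def)
  ultimately show "v \<in> decoding_vertices C d M" using assms unfolding decoding_vertices_def by blast
qed

section \<open>Edges of faults and the counting argument\<close>

text \<open>Labels edges by faults. The map is not injective in general, and its value can be empty,
  in which case it is no decoding edge.\<close>

definition edge_of :: "'q fault \<Rightarrow> 'q detector set" where
  "edge_of f = hyperedge C d f \<inter> decoding_vertices C d M"

lemma edge_of_strip:
  "v \<in> strip_detectors C d M k \<Longrightarrow> v \<in> edge_of f \<longleftrightarrow> fault_flips_detector C d f v"
  using strip_subset strip_subset_decoding_vertices by (auto simp: edge_of_def hyperedge_def)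

lemma decoding_vertices_detectors: "decoding_vertices C d M \<subseteq> detectors C d"
  by (auto simp: decoding_vertices_def)

text \<open>Since strips consist of decoding vertices, the effect of a fault on all shifted readouts
  is determined by its edge and its effect on the observable.\<close>

lemma flips_shifted_edge:
  assumes "0 \<le> k" "k < int d"
  shows "(of_bool (flips_shifted k f) :: bit) = of_bool (fault_flips_observable C d M f)
    + (\<Sum>v\<in>strip_detectors C d M k. of_bool (v \<in> edge_of f))"
  unfolding flips_shifted_eq[OF assms] using edge_of_strip by (simp cong: sum.cong)

text \<open>
  For \<open>d = 2\<close> this can fail: the \<open>X\<close> faults at the two ends of a boundary \<open>Z\<close>-check have the same edge,
  but only one of them flips \<open>O\<close>. In that case, however, only \<open>F = {}\<close> is possible.
\<close>

lemma same_edge_same_observable: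
  assumes "d \<ge> 3" "f \<in> basic_faults C d" "g \<in> basic_faults C d" "edge_of f = edge_of g"
  shows "fault_flips_observable C d M f = fault_flips_observable C d M g"
proof (rule ccontr)
  assume ne: "fault_flips_observable C d M f \<noteq> fault_flips_observable C d M g"
  have "flips_shifted k f \<noteq> flips_shifted k g" if k: "0 \<le> k" "k < int d" for k
  proof
    assume "flips_shifted k f = flips_shifted k g"
    then have "of_bool (fault_flips_observable C d M f) = (of_bool (fault_flips_observable C d M g) :: bit)"
      using flips_shifted_edge[OF k, of f] flips_shifted_edge[OF k, of g] assms(4) by simp
    then show False using ne by (simp only: of_bool_eq_iff)
  qed
  \<comment> \<open>Faults with equal edges and different effects on the observable would differ on
    each of the readouts 0, 1 and 2, but two faults flip at most two readouts in total.\<close>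
  note differ = this[of 0] this[of 1] this[of 2]
  note unique = flips_shifted_unique[of _ 0 1] flips_shifted_unique[of _ 0 2] flips_shifted_unique[of _ 1 2]
  show False
    using differ unique[OF assms(2)] unique[OF assms(3)] assms(1) by auto
qed

text \<open>Membership only yields some fault with this edge that flips the observable;
  \<open>same_edge_same_observable\<close> transfers this to \<open>f\<close>.\<close>

lemma observing_edge_of:
  assumes "d \<ge> 3" "f \<in> basic_faults C d"
  shows "edge_of f \<in> observing_edges C d M \<longleftrightarrow> fault_flips_observable C d M f"
proof
  assume "edge_of f \<in> observing_edges C d M"
  then obtain g where g: "g \<in> basic_faults C d" "fault_flips_observable C d M g"
      "edge_of f = hyperedge C d g"
    and "hyperedge C d g \<in> observing_edges C d M"
    by (auto simp: observing_edges_def)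
  then have "edge_of f = edge_of g" using observing_edge_subset by (auto simp: edge_of_def)
  then show "fault_flips_observable C d M f"
    using same_edge_same_observable[OF assms(1,2) g(1)] g(2) by simp
next
  assume "fault_flips_observable C d M f"
  then have "hyperedge C d f \<in> observing_edges C d M" using assms(2) by (auto simp: observing_edges_def)
  then show "edge_of f \<in> observing_edges C d M"
    using observing_edge_subset by (simp add: edge_of_def Int_absorb2)
qed

lemma decoding_edges_eq: "decoding_edges C d M = edge_of ` basic_faults C d - {{}}"
  by (auto simp: decoding_edges_def hyperedges_def edge_of_def)

lemma edge_of_boundary:
  assumes "finite A" "inj_on edge_of A"
  shows "v \<in> edge_boundary (decoding_vertices C d M) (edge_of ` A)
    \<longleftrightarrow> v \<in> decoding_vertices C d M \<and> odd (card {f \<in> A. v \<in> edge_of f})"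
proof -
  have "{e \<in> edge_of ` A. v \<in> e} = edge_of ` {f \<in> A. v \<in> edge_of f}" by auto
  moreover have "card (edge_of ` {f \<in> A. v \<in> edge_of f}) = card {f \<in> A. v \<in> edge_of f}"
    by (rule card_image[OF inj_on_subset[OF assms(2)]]) auto
  ultimately show ?thesis by (simp add: edge_boundary_def)
qed

text \<open>If the effects on the observable differed, the total flips of every readout would differ
  too, so each of the \<open>d\<close> indices would need a fault of its own in
  \<open>F \<union> G\<close>.\<close>

lemma small_faults_same_boundary:
  assumes F: "F \<subseteq> basic_faults C d" and G: "G \<subseteq> basic_faults C d" and small: "card F + card G < d"
    and same: "\<And>v. v \<in> decoding_vertices C d M \<Longrightarrow>
      odd (card {f \<in> F. v \<in> edge_of f}) \<longleftrightarrow> odd (card {f \<in> G. v \<in> edge_of f})"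
  shows "flips_observable C d M F = flips_observable C d M G"
proof (rule ccontr)
  assume ne: "flips_observable C d M F \<noteq> flips_observable C d M G"
  have fin: "finite F" "finite G"
    using F G finite_basic_faults[OF bare] finite_subset by blast+
  define s where "s H k = (\<Sum>f\<in>H. of_bool (flips_shifted k f) :: bit)" for H :: "'q fault set" and k
  have s: "s H k = of_bool (flips_observable C d M H)
      + (\<Sum>v\<in>strip_detectors C d M k. of_bool (odd (card {f \<in> H. v \<in> edge_of f})))"
    if "finite H" "0 \<le> k" "k < int d" for H k
    unfolding s_def flips_shifted_edge[OF that(2,3)] sum.distrib flips_observable_def
      of_bool_odd_card[OF that(1)]
    by (subst sum.swap) simp
  have "\<exists>f\<in>F \<union> G. flips_shifted k f" if k: "0 \<le> k" "k < int d" for k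
  proof (rule ccontr)
    assume "\<not> ?thesis"
    then have "s F k = s G k" by (simp add: s_def)
    moreover have "(\<Sum>v\<in>strip_detectors C d M k. of_bool (odd (card {f \<in> F. v \<in> edge_of f})) :: bit)
       = (\<Sum>v\<in>strip_detectors C d M k. of_bool (odd (card {f \<in> G. v \<in> edge_of f})))"
      by (intro sum.cong refl) (simp only: same[OF subsetD[OF strip_subset_decoding_vertices]])
    ultimately have "(of_bool (flips_observable C d M F) :: bit) = of_bool (flips_observable C d M G)"
      using s[OF fin(1) k] s[OF fin(2) k] by simp
    then show False using ne by (simp only: of_bool_eq_iff)
  qed
  then obtain h where h: "\<And>k. k \<in> {0..<int d} \<Longrightarrow> h k \<in> F \<union> G \<and> flips_shifted k (h k)"
    by (metis atLeastLessThan_iff)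
  have "inj_on h {0..<int d}"
    using h flips_shifted_unique F G by (intro inj_onI) (metis Un_least subsetD)
  moreover have "h ` {0..<int d} \<subseteq> F \<union> G" using h by blast
  ultimately have "card {0..<int d} \<le> card (F \<union> G)"
    using fin by (intro card_inj_on_le[of h]) simp_all
  then show False using small card_Un_le[of F G] by simp
qed

end

section \<open>Correctness of minimum-weight matching\<close>

theorem theorem1:
  fixes C :: "'q circuit" and d :: nat and M :: "(int \<times> 'q) set"
    and F :: "'q fault set" and c :: "'q detector set set"
  assumes "d \<ge> 2"
    and "bare_circuit C"
    and "observable C M"
    and "reliable C M"
    and "F \<subseteq> basic_faults C d"
    and "2 * card F < d"
    and "minimum_weight_matching (decoding_vertices C d M) (decoding_edges C d M)
           {v \<in> decoding_vertices C d M. flips_detector C d F v} c"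
  shows "predicts_flip C d M c \<longleftrightarrow> flips_observable C d M F"
proof -
  interpret encoded_observable C d M using assms by unfold_locales
  let ?V = "decoding_vertices C d M" and ?E = "decoding_edges C d M"
    and ?D = "{v \<in> decoding_vertices C d M. flips_detector C d F v}"
  have c: "c \<subseteq> ?E" "edge_boundary ?V c = ?D"
    and min: "\<And>c'. c' \<subseteq> ?E \<Longrightarrow> edge_boundary ?V c' = ?D \<Longrightarrow> card c \<le> card c'"
    using assms(7) by (auto simp: minimum_weight_matching_def)
  have finF: "finite F" using assms(5) finite_basic_faults[OF bare] finite_subset by blast
  have finc: "finite c" using c(1) finite_decoding_edges[OF bare] finite_subset by blast
  have flips: "flips_detector C d F v \<longleftrightarrow> odd (card {f \<in> F. v \<in> edge_of f})" if "v \<in> ?V" for v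
  proof -
    have "{f \<in> F. v \<in> edge_of f} = {f \<in> F. fault_flips_detector C d f v}"
      using that decoding_vertices_detectors by (auto simp: edge_of_def hyperedge_def)
    then show ?thesis by (simp add: flips_detector_def)
  qed
  \<comment> \<open>Distinct faults may have equal edges; such edges have to be counted modulo 2.\<close>
  define cF where "cF = {e. e \<noteq> {} \<and> odd (card {f \<in> F. edge_of f = e})}"
  have cF: "cF \<subseteq> edge_of ` F"
  proof
    fix e assume "e \<in> cF"
    then have "{f \<in> F. edge_of f = e} \<noteq> {}" by (auto simp: cF_def simp del: Collect_empty_eq)
    then show "e \<in> edge_of ` F" by auto
  qed
  then have fincF: "finite cF" using finF finite_surj by blast
  have "edge_boundary ?V cF = ?D"
  proof -
    have "odd (card {e \<in> cF. v \<in> e}) \<longleftrightarrow> odd (card {f \<in> F. v \<in> edge_of f})" for v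
    proof -
      have "(of_bool (odd (card {e \<in> cF. v \<in> e})) :: bit) = (\<Sum>e\<in>cF. of_bool (v \<in> e))"
        by (rule of_bool_odd_card[OF fincF])
      also have "\<dots> = (\<Sum>e\<in>edge_of ` F. of_bool (odd (card {f \<in> F. edge_of f = e})) * of_bool (v \<in> e))"
        using cF finF by (intro sum.mono_neutral_cong_left) (auto simp: cF_def)
      also have "\<dots> = (\<Sum>e\<in>edge_of ` F. \<Sum>f\<in>F. of_bool (edge_of f = e) * of_bool (v \<in> e))"
        by (simp add: of_bool_odd_card[OF finF] sum_distrib_right del: of_bool_eq_iff)
      also have "\<dots> = (\<Sum>f\<in>F. \<Sum>e\<in>edge_of ` F. if e = edge_of f then of_bool (v \<in> edge_of f) else 0)"
        by (subst sum.swap) (intro sum.cong refl; simp)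
      also have "\<dots> = (\<Sum>f\<in>F. of_bool (v \<in> edge_of f))"
        using finF by (intro sum.cong refl) simp
      also have "\<dots> = of_bool (odd (card {f \<in> F. v \<in> edge_of f}))"
        by (rule of_bool_odd_card[OF finF, symmetric])
      finally show ?thesis by (simp only: of_bool_eq_iff)
    qed
    then show ?thesis using flips by (auto simp: edge_boundary_def)
  qed
  moreover have "cF \<subseteq> ?E" using cF assms(5) by (auto simp: decoding_edges_eq) (simp add: cF_def)
  \<comment> \<open>The reduced error \<open>cF\<close> has the required boundary and thus competes
    with \<open>c\<close>; this is the only use of minimality.\<close>
  ultimately have "card c \<le> card cF" by (intro min)
  also have "\<dots> \<le> card (edge_of ` F)" using cF finF by (intro card_mono) auto
  also have "\<dots> \<le> card F" by (rule card_image_le[OF finF])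
  finally have cardc: "card c \<le> card F" .
  show ?thesis
  proof (cases "F = {}")
    case True
    then have "c = {}" using cardc finc by simp
    then show ?thesis using True by (simp add: predicts_flip_def flips_observable_def)
  next
    case False
    then have "card F \<noteq> 0" using finF by simp
    then have d: "d \<ge> 3" using assms(6) by linarith
    have "c \<subseteq> edge_of ` basic_faults C d" using c(1) by (auto simp: decoding_edges_eq)
    \<comment> \<open>One fault is chosen for each edge of \<open>c\<close>, so that
      \<open>c\<close> becomes a set of faults of the same size, to be compared with
      \<open>F\<close>.\<close>
    then obtain G where G: "G \<subseteq> basic_faults C d" "inj_on edge_of G" "c = edge_of ` G"
      by (meson subset_image_inj)
    have finG: "finite G" using G(1) finite_basic_faults[OF bare] finite_subset by blast
    have "card G = card c" using G card_image by fastforce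
    moreover have "odd (card {f \<in> F. v \<in> edge_of f}) \<longleftrightarrow> odd (card {f \<in> G. v \<in> edge_of f})"
      if "v \<in> ?V" for v
      using edge_of_boundary[OF finG G(2), of v] c(2) flips[OF that] that unfolding G(3) by simp
    ultimately have "flips_observable C d M F = flips_observable C d M G"
      using assms(5,6) G(1) cardc by (intro small_faults_same_boundary) auto
    also have "\<dots> \<longleftrightarrow> predicts_flip C d M c"
    proof -
      have "c \<inter> observing_edges C d M = edge_of ` {f \<in> G. fault_flips_observable C d M f}"
        using G(1) observing_edge_of[OF d] by (auto simp: G(3))
      moreover have "card (edge_of ` {f \<in> G. fault_flips_observable C d M f})
          = card {f \<in> G. fault_flips_observable C d M f}"
        by (rule card_image[OF inj_on_subset[OF G(2)]]) auto
      ultimately show ?thesis by (simp add: predicts_flip_def flips_observable_def)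
    qed
    finally show ?thesis ..
  qed
qed

end
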